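(* Let $\alpha\in[\frac12,1]$ and $\lambda>0$. For $K\in\mathbb{N}$ and $\delta=1/K$, let $\vec{\mathrm x}_\delta^{\min}$ be the unique minimizer of $\mathbf H_{\alpha,\lambda}$ on $\mathfrak x_\delta$, let $u_\delta^{\min}=\mathbf u_\delta[\vec{\mathrm x}_\delta^{\min}]$ be the associated piecewise constant density, and let $\hat u_\delta^{\min}$ be its locally affine interpolation. Then, as $\delta\to0$ (i.e. $K\to\infty$), $$u_\delta^{\min}\longrightarrow \mathrm b_{\alpha,\lambda}\quad\text{strongly in } L^p(\mathbb R)\text{ for every real } p\ge 1,$$ $$\hat u_\delta^{\min}\longrightarrow \mathrm b_{\alpha,\lambda}\quad\text{uniformly on }\mathbb R.$$
   Context: For $K\in\mathbb N$ put $\delta=1/K$ (the total mass is $M=1$), $\xi_k=k\delta$ for $k=0,\dots,K$, and $\xi_{k-\frac12}=\frac12(\xi_{k-1}+\xi_k)$ for $k=1,\dots,K$. Let $\mathfrak x_\delta=\{\vec{\mathrm x}=(x_0,\dots,x_K)\in\mathbb R^{K+1}: x_0<x_1<\dots<x_K\}$. For $\vec{\mathrm x}\in\mathfrak x_\delta$ set $z_{k-\frac12}=\delta/(x_k-x_{k-1})$ for $k=1,\dots,K$ and $z_{-\frac12}=z_{K+\frac12}=0$, and let $$\mathbf u_\delta[\vec{\mathrm x}](x)=\sum_{k=1}^K \frac{\delta}{x_k-x_{k-1}}\mathbf 1_{(x_{k-1},x_k]}(x),\qquad x\in\mathbb R.$$ Let $\mathbf X_\delta[\vec{\mathrm x}]:[0,1]\to\mathbb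 R$ be the continuous function that is affine on each $[\xi_{k-1},\xi_k]$ with $\mathbf X_\delta[\vec{\mathrm x}](\xi_k)=x_k$. Constants: $\Theta_\alpha=\sqrt{2\alpha}/(2\alpha+1)$, $\Lambda_{\alpha,\lambda}=\sqrt{\lambda/(2\alpha+1)}$. Let $f_\alpha(s)=\Theta_\alpha\frac{s^{\alpha-1/2}}{\alpha-1/2}$ for $\alpha\in(\frac12,1]$ and $f_{1/2}(s)=\Theta_{1/2}\ln s$. The discrete entropy on $\mathfrak x_\delta$ is $$\mathbf H_{\alpha,\lambda}(\vec{\mathrm x})=\delta\sum_{k=1}^K f_\alpha(z_{k-\frac12})+\frac{\Lambda_{\alpha,\lambda}}2\,\delta\sum_{k=0}^K|x_k|^2;$$ for $\lambda>0$ it has a unique minimizer $\vec{\mathrm x}_\delta^{\min}\in\mathfrak x_\delta$. The interpolation $\hat u_\delta^{\min}$: with $z_{k-\frac12}$ formed from $\vec{\mathrm x}=\vec{\mathrm x}_\delta^{\min}$, it is the continuous function on $[x_0,x_K]$ with $\hat u_\delta^{\min}(\mathbf X_\delta[\vec{\mathrm x}](\xi_{k-\frac12}))=z_{k-\frac12}$ for $k=1,\dots,K$, and $\hat u_\delta^{\min}(\mathbf X_\delta[\vec{\mathrm x}](\xi_k))=\frac12(z_{k+\frac12}+z_{k-\frac12})$ for $k=0,\dots,K$, affine between consecutive such points; outside $[x_0,x_K]$ it is $0$. The limit profile is the Barenblatt profile, resp. Gaussian, $$\mathrm b_{\alpha,\lambda}(x)=\big(a-b|x|^2\big)_+^{1/(\alpha-1/2)},\quad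 b=\frac{\alpha-1/2}{\sqrt{2\alpha}}\Lambda_{\alpha,\lambda}\quad(\alpha>\tfrac12),\qquad \mathrm b_{1/2,\lambda}(x)=a\,e^{-\Lambda_{1/2,\lambda}|x|^2}\quad(\alpha=\tfrac12),$$ where $a\in\mathbb R$ is chosen so that the profile has integral $1$ over $\mathbb R$. *)

theory Defs
  imports "HOL-Analysis.Analysis"
begin

text \<open>
  Half-integer indices are shifted: the quantity with index k - 1/2 is stored at the natural number k.
\<close>

definition delta :: "nat \<Rightarrow> real" where
  "delta K = 1 / real K"

definition xi :: "nat \<Rightarrow> nat \<Rightarrow> real" where
  "xi K k = real k * delta K"

definition xi_mid :: "nat \<Rightarrow> nat \<Rightarrow> real" where
  "xi_mid K k = (xi K (k - 1) + xi K k) / 2"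

text \<open>
  Vectors indexed by 0, ..., K are extensional functions, so that equality of vectors
  is equality of their K + 1 entries.
\<close>

definition configs :: "nat \<Rightarrow> (nat \<Rightarrow> real) set" where
  "configs K = {x \<in> {0..K} \<rightarrow>\<^sub>E UNIV. strict_mono_on {0..K} x}"

text \<open>
  The values at k = 0 and k = K + 1 are the boundary conventions at -1/2 and K + 1/2.
\<close>

definition zval :: "nat \<Rightarrow> (nat \<Rightarrow> real) \<Rightarrow> nat \<Rightarrow> real" where
  "zval K x k = (if 1 \<le> k \<and> k \<le> K then delta K / (x k - x (k - 1)) else 0)"

definition u_delta :: "nat \<Rightarrow> (nat \<Rightarrow> real) \<Rightarrow> real \<Rightarrow> real" where
  "u_delta K x s = (\<Sum>k = 1..K. delta K / (x k - x (k - 1)) * indicator {x (k - 1)<..x k} s)"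

text \<open>
  The continuous function on [t 0, t n] that is affine on each [t i, t (i + 1)] and takes the
  value v i at t i, extended by 0 to the real line. Meaningful if t is strictly increasing on
  0, ..., n and n is positive; the lemmas below characterize it.
\<close>

definition pw_affine :: "nat \<Rightarrow> (nat \<Rightarrow> real) \<Rightarrow> (nat \<Rightarrow> real) \<Rightarrow> real \<Rightarrow> real" where
  "pw_affine n t v s =
     (if t 0 \<le> s \<and> s \<le> t n
      then let i = (LEAST i. s \<le> t (Suc i))
           in v i + (v (Suc i) - v i) / (t (Suc i) - t i) * (s - t i)
      else 0)"

lemma pw_affine_outside: "s \<notin> {t 0..t n} \<Longrightarrow> pw_affine n t v s = 0"
  by (auto simp: pw_affine_def)

lemma pw_affine_on_piece:
  assumes mono: "strict_mono_on {0..n} t" and i: "i < n" and s: "s \<in> {t i..t (Suc i)}"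
  shows "pw_affine n t v s = v i + (v (Suc i) - v i) / (t (Suc i) - t i) * (s - t i)"
proof -
  have less: "t j < t k" if "j < k" "k \<le> n" for j k
    using mono that by (auto simp: strict_mono_on_def)
  have le: "t j \<le> t k" if "j \<le> k" "k \<le> n" for j k
    using less[of j k] that by (cases "j = k") auto
  have range: "t 0 \<le> s" "s \<le> t n"
    using le[of 0 i] le[of "Suc i" n] i s by auto
  define m where "m = (LEAST j. s \<le> t (Suc j))"
  have m: "s \<le> t (Suc m)" unfolding m_def by (rule LeastI[of _ i]) (use s in auto)
  have m_le: "m \<le> i" unfolding m_def by (rule Least_le) (use s in auto)
  have val: "pw_affine n t v s = v m + (v (Suc m) - v m) / (t (Suc m) - t m) * (s - t m)"
    using range by (simp add: pw_affine_def Let_def m_def)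
  show ?thesis
  proof (cases "m = i")
    case True
    then show ?thesis using val by simp
  next
    case False
    with m_le have "Suc m \<le> i" by simp
    with le[of "Suc m" i] i have "t (Suc m) \<le> t i" by simp
    with m s have st: "s = t i" "t (Suc m) = t i" by auto
    have "\<not> Suc m < i" using less[of "Suc m" i] st(2) i by auto
    with \<open>Suc m \<le> i\<close> have "Suc m = i" by simp
    moreover have "t m < t i" using less[of m i] \<open>Suc m = i\<close> i by simp
    ultimately show ?thesis using val st by auto
  qed
qed

lemma pw_affine_node:
  assumes mono: "strict_mono_on {0..n} t" and "0 < n" and "i \<le> n"
  shows "pw_affine n t v (t i) = v i"
proof (cases "i < n")
  case True
  have "t i < t (Suc i)" using mono True by (auto simp: strict_mono_on_def)
  then show ?thesis using pw_affine_on_piece[OF mono True, of "t i" v] by simp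
next
  case False
  with assms obtain j where j: "i = Suc j" "j < n" by (cases i) auto
  have "t j < t (Suc j)" using mono j by (auto simp: strict_mono_on_def)
  then show ?thesis using pw_affine_on_piece[OF mono j(2), of "t (Suc j)" v] j by simp
qed

definition X_delta :: "nat \<Rightarrow> (nat \<Rightarrow> real) \<Rightarrow> real \<Rightarrow> real" where
  "X_delta K x = pw_affine K (xi K) x"

text \<open>
  The interpolation nodes of u_hat are numbered 0, ..., 2 K: node 2 k sits over xi K k,
  and node 2 k - 1 sits over xi_mid K k.
\<close>

definition hat_node :: "nat \<Rightarrow> (nat \<Rightarrow> real) \<Rightarrow> nat \<Rightarrow> real" where
  "hat_node K x j =
     X_delta K x (if even j then xi K (j div 2) else xi_mid K (Suc j div 2))"

definition hat_value :: "nat \<Rightarrow> (nat \<Rightarrow> real) \<Rightarrow> nat \<Rightarrow> real" where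
  "hat_value K x j =
     (if even j then (zval K x (Suc (j div 2)) + zval K x (j div 2)) / 2
      else zval K x (Suc j div 2))"

definition u_hat :: "nat \<Rightarrow> (nat \<Rightarrow> real) \<Rightarrow> real \<Rightarrow> real" where
  "u_hat K x = pw_affine (2 * K) (hat_node K x) (hat_value K x)"

definition Theta_const :: "real \<Rightarrow> real" where
  "Theta_const \<alpha> = sqrt (2 * \<alpha>) / (2 * \<alpha> + 1)"

definition Lambda_const :: "real \<Rightarrow> real \<Rightarrow> real" where
  "Lambda_const \<alpha> lam = sqrt (lam / (2 * \<alpha> + 1))"

definition f_ent :: "real \<Rightarrow> real \<Rightarrow> real" where
  "f_ent \<alpha> s =
     (if \<alpha> = 1/2 then Theta_const \<alpha> * ln s
      else Theta_const \<alpha> * (s powr (\<alpha> - 1/2) / (\<alpha> - 1/2)))"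

definition H_ent :: "real \<Rightarrow> real \<Rightarrow> nat \<Rightarrow> (nat \<Rightarrow> real) \<Rightarrow> real" where
  "H_ent \<alpha> lam K x =
     delta K * (\<Sum>k = 1..K. f_ent \<alpha> (zval K x k))
     + Lambda_const \<alpha> lam / 2 * delta K * (\<Sum>k = 0..K. \<bar>x k\<bar>\<^sup>2)"

definition x_min :: "real \<Rightarrow> real \<Rightarrow> nat \<Rightarrow> nat \<Rightarrow> real" where
  "x_min \<alpha> lam K = (THE x. is_arg_min (H_ent \<alpha> lam K) (\<lambda>y. y \<in> configs K) x)"

definition profile :: "real \<Rightarrow> real \<Rightarrow> real \<Rightarrow> real \<Rightarrow> real" where
  "profile \<alpha> lam a x =
     (if \<alpha> = 1/2 then a * exp (- Lambda_const \<alpha> lam * \<bar>x\<bar>\<^sup>2)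
      else max 0 (a - (\<alpha> - 1/2) / sqrt (2 * \<alpha>) * Lambda_const \<alpha> lam * \<bar>x\<bar>\<^sup>2)
             powr (1 / (\<alpha> - 1/2)))"

definition barenblatt :: "real \<Rightarrow> real \<Rightarrow> real \<Rightarrow> real" where
  "barenblatt \<alpha> lam =
     profile \<alpha> lam (THE a. has_bochner_integral lborel (profile \<alpha> lam a) 1)"

definition in_Lp :: "real \<Rightarrow> (real \<Rightarrow> real) \<Rightarrow> bool" where
  "in_Lp p f \<longleftrightarrow> f \<in> borel_measurable lborel \<and> integrable lborel (\<lambda>x. \<bar>f x\<bar> powr p)"

definition Lp_norm :: "real \<Rightarrow> (real \<Rightarrow> real) \<Rightarrow> real" where
  "Lp_norm p f = (LINT x|lborel. \<bar>f x\<bar> powr p) powr (1 / p)"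

definition converges_in_Lp :: "real \<Rightarrow> (nat \<Rightarrow> real \<Rightarrow> real) \<Rightarrow> (real \<Rightarrow> real) \<Rightarrow> bool" where
  "converges_in_Lp p f g \<longleftrightarrow>
     (\<forall>n. in_Lp p (f n)) \<and> in_Lp p g \<and> (\<lambda>n. Lp_norm p (\<lambda>x. f n x - g x)) \<longlonglongrightarrow> 0"

end

theory Submission
  imports Defs "HOL-Probability.Distributions"
begin

text \<open>
  Write \<open>z k\<close> for the density on the \<open>k\<close>-th cell of the minimizer \<open>x\<close>, \<open>\<Theta>\<close> and \<open>\<Lambda>\<close> for the two constants,
  \<open>P s = \<Theta> s powr (\<alpha> + 1/2)\<close>, \<open>\<delta> = 1 / K\<close> and \<open>h = (\<alpha> + 1/2) f\<close>. The entropy is strictly convex and coercive on the configurations, so it has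
  exactly one minimizer, and this is the solution of \<open>P (z k) - P (z (k + 1)) = \<Lambda> \<delta> (x k)\<close> for \<open>k = 0, \<dots>, K\<close>, where \<open>z 0 = z (K + 1) = 0\<close>
  (\<open>x_min_steady\<close>). This discretizes \<open>P(u)' = - \<Lambda> x u\<close>. Since \<open>h' = P' / s\<close>, the continuous equation says that \<open>h(u) + \<Lambda> x\<^sup>2 / 2\<close>
  is a constant \<open>c\<close> where \<open>u\<close> is positive, so that \<open>u = h\<^sup>-\<^sup>1 (c - \<Lambda> x\<^sup>2 / 2)\<close>; this is the Barenblatt profile, or the Gaussian, and \<open>c\<close> is fixed by the
  mass.

  The discrete equilibrium keeps this conserved quantity in the form of two monotone ones: for arbitrary \<open>k\<close>, and whatever the sign of \<open>x k\<close>,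
  \<open>h (z k) + \<Lambda> (x k)\<^sup>2 / 2\<close> does not decrease in \<open>k\<close> and \<open>h (z k) + \<Lambda> (x (k - 1))\<^sup>2 / 2\<close> does not increase in \<open>k\<close>
  (\<open>right_energy_step\<close>, \<open>left_energy_antimono\<close>). Comparison with the cell \<open>j\<close> that contains the origin, where \<open>z\<close> is largest, squeezes \<open>z\<close>: at
  a point \<open>s\<close> of the \<open>k\<close>-th cell, the profile of level \<open>c = h (z j)\<close> is at most the value of \<open>z\<close> one cell nearer to the origin (or \<open>z j\<close>, if \<open>k = j\<close>), and the profile of a
  slightly higher level is at least the value one cell farther out. So the density differs from the profile of level \<open>c\<close> by at most
  the largest jump of \<open>z\<close> plus a multiple of the difference of the two levels (\<open>cell\<close>, \<open>outside\<close>). The jumps are governed by \<open>\<Lambda> \<delta> |x k|\<close>, and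
  this is small because \<open>(x k)\<^sup>2\<close> grows by at most a constant from one cell to the next, hence \<open>(x k)\<^sup>2 = O(K)\<close> (\<open>x_square_step\<close>, \<open>jump\<close>).

  The maximum \<open>z j\<close> stays between two positive constants, so the levels stay in a compact interval. Along any subsequence along which they
  converge the densities converge to a profile, and they are dominated by one integrable profile, so the limit has mass 1. As only one level
  has mass 1, all levels converge to it (\<open>minimizers_converge\<close>). This gives uniform convergence of the densities, and with the domination
  convergence in every \<open>L\<^sup>p\<close>; the interpolation stays within one jump of the density on each closed cell (\<open>u_hat_cell\<close>).
\<close>

section \<open>The flux, the enthalpy and the limiting profiles\<close>

lemma min_at_sign_change:
  fixes h h' :: "real \<Rightarrow> real"
  assumes der: "\<And>s. 0 < s \<Longrightarrow> (h has_real_derivative h' s) (at s)"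
    and neg: "\<And>s. 0 < s \<Longrightarrow> s \<le> z \<Longrightarrow> h' s \<le> 0"
    and pos: "\<And>s. z \<le> s \<Longrightarrow> 0 \<le> h' s"
    and z: "0 < z" and s: "0 < s"
  shows "h z \<le> h s"
proof (cases "z \<le> s")
  case True
  show ?thesis
    by (rule DERIV_nonneg_imp_nondecreasing[OF True]) (use der pos z in \<open>metis order_less_le_trans\<close>)
next
  case False
  then have "s \<le> z" by simp
  then show ?thesis
    by (rule DERIV_nonpos_imp_nonincreasing) (use der neg s in \<open>metis order_less_le_trans\<close>)
qed

definition flux :: "real \<Rightarrow> real \<Rightarrow> real" where
  "flux \<alpha> s = Theta_const \<alpha> * s powr (\<alpha> + 1/2)"

text \<open>
  The function with \<open>h' = P' / s\<close>; it is proportional to the entropy density.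
\<close>
definition enthalpy :: "real \<Rightarrow> real \<Rightarrow> real" where
  "enthalpy \<alpha> s = (\<alpha> + 1/2) * f_ent \<alpha> s"

text \<open>
  The inverse of the enthalpy, extended by 0 below the range of the enthalpy when \<open>\<alpha> > 1/2\<close>.
\<close>
definition enthalpy_inv :: "real \<Rightarrow> real \<Rightarrow> real" where
  "enthalpy_inv \<alpha> y =
     (if \<alpha> = 1/2 then exp (2 * y)
      else max 0 ((2 * \<alpha> - 1) / sqrt (2 * \<alpha>) * y) powr (1 / (\<alpha> - 1/2)))"

text \<open>
  The parameter \<open>a\<close> of the profile family that belongs to the level \<open>c\<close>. Levels treat the Gaussian and the Barenblatt case alike,
  and they turn multiplication of Gaussians into translation.
\<close>
definition amplitude :: "real \<Rightarrow> real \<Rightarrow> real" where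
  "amplitude \<alpha> c = (if \<alpha> = 1/2 then exp (2 * c) else (2 * \<alpha> - 1) / sqrt (2 * \<alpha>) * c)"

text \<open>
  The solution \<open>u\<close> of \<open>h u + \<Lambda> s\<^sup>2 / 2 = c\<close>, extended by 0.
\<close>
definition level_profile :: "real \<Rightarrow> real \<Rightarrow> real \<Rightarrow> real \<Rightarrow> real" where
  "level_profile \<alpha> lam c s = enthalpy_inv \<alpha> (c - Lambda_const \<alpha> lam / 2 * s\<^sup>2)"

locale entropy_params =
  fixes \<alpha> lam :: real
  assumes alpha_ge: "1/2 \<le> \<alpha>" and alpha_le: "\<alpha> \<le> 1" and lam_pos: "0 < lam"
begin

abbreviation "\<Theta> \<equiv> Theta_const \<alpha>"
abbreviation "\<Lambda> \<equiv> Lambda_const \<alpha> lam"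
abbreviation "f \<equiv> f_ent \<alpha>"
abbreviation "P \<equiv> flux \<alpha>"
abbreviation "h \<equiv> enthalpy \<alpha>"
abbreviation "hinv \<equiv> enthalpy_inv \<alpha>"
abbreviation "B \<equiv> level_profile \<alpha> lam"

lemma Theta_pos: "0 < \<Theta>"
  using alpha_ge by (simp add: Theta_const_def)

lemma Lambda_pos: "0 < \<Lambda>"
  using alpha_ge lam_pos by (simp add: Lambda_const_def)

lemma f_deriv:
  assumes "0 < s"
  shows "(f has_real_derivative \<Theta> * s powr (\<alpha> - 3/2)) (at s)"
proof (cases "\<alpha> = 1/2")
  case True
  have eq: "f_ent \<alpha> = (\<lambda>s. \<Theta> * ln s)" using True by (auto simp: f_ent_def)
  have "s powr (\<alpha> - 3/2) = 1 / s"
    using assms True by (simp add: powr_minus powr_one divide_simps)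
  then show ?thesis unfolding eq
    by (auto intro!: derivative_eq_intros simp: assms)
next
  case False
  have eq: "f_ent \<alpha> = (\<lambda>s. \<Theta> * (s powr (\<alpha> - 1/2) / (\<alpha> - 1/2)))" using False by (auto simp: f_ent_def)
  have "((\<lambda>s. s powr (\<alpha> - 1/2)) has_real_derivative (\<alpha> - 1/2) * s powr (\<alpha> - 1/2 - 1)) (at s)"
    using assms by (rule has_real_derivative_powr)
  from DERIV_cmult[OF DERIV_cdivide[OF this, of "\<alpha> - 1/2"], of \<Theta>]
  have "(f_ent \<alpha> has_real_derivative \<Theta> * ((\<alpha> - 1/2) * s powr (\<alpha> - 1/2 - 1) / (\<alpha> - 1/2))) (at s)"
    by (simp only: eq)
  moreover have "\<alpha> - 1/2 - 1 = \<alpha> - 3/2" by simp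
  ultimately show ?thesis using False by simp
qed

lemma flux_deriv:
  assumes "0 < s"
  shows "(P has_real_derivative \<Theta> * ((\<alpha> + 1/2) * s powr (\<alpha> - 1/2))) (at s)"
proof -
  have "((\<lambda>s. s powr (\<alpha> + 1/2)) has_real_derivative (\<alpha> + 1/2) * s powr (\<alpha> + 1/2 - 1)) (at s)"
    using assms by (rule has_real_derivative_powr)
  from DERIV_cmult[OF this, of \<Theta>] show ?thesis
    by (simp add: flux_def[abs_def] algebra_simps)
qed

lemma flux_0 [simp]: "P 0 = 0" by (simp add: flux_def)

lemma flux_pos: "0 < s \<Longrightarrow> 0 < P s" using Theta_pos by (simp add: flux_def)

lemma flux_mono: "0 \<le> s \<Longrightarrow> s \<le> t \<Longrightarrow> P s \<le> P t"
  using Theta_pos alpha_ge by (simp add: flux_def powr_mono2)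

lemma flux_le_iff: "0 \<le> s \<Longrightarrow> 0 \<le> t \<Longrightarrow> P s \<le> P t \<longleftrightarrow> s \<le> t"
  using Theta_pos alpha_ge powr_less_mono2[of "\<alpha> + 1/2" t s] powr_mono2[of "\<alpha> + 1/2" s t]
  by (simp add: flux_def) linarith

text \<open>
  The difference quotient of \<open>h\<close> with respect to \<open>P\<close> lies between \<open>1 / a\<close> and \<open>1 / b\<close>, because \<open>dh / dP = 1 / s\<close>. The inequality holds in
  this form for both orders of \<open>a\<close> and \<open>b\<close>, so that it covers \<open>x k\<close> of either sign later.
\<close>
lemma enthalpy_diff_le:
  assumes "0 < a" "0 < b"
  shows "h a - h b \<le> (P a - P b) / b"
proof -
  \<comment> \<open>\<open>P s / b - h s\<close> has derivative \<open>P' s (1 / b - 1 / s)\<close>, so its minimum is at \<open>b\<close>.\<close>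
  have "P b / b - h b \<le> P a / b - h a"
  proof (rule min_at_sign_change[OF _ _ _ assms(2) assms(1),
        where h' = "\<lambda>s. \<Theta> * (\<alpha> + 1/2) * s powr (\<alpha> - 3/2) * (s / b - 1)"])
    fix s :: real assume s: "0 < s"
    have e: "s powr (\<alpha> - 1/2) = s powr (\<alpha> - 3/2) * s"
      using s powr_add[of s "\<alpha> - 3/2" 1] by simp
    have d: "((\<lambda>s. P s / b - h s) has_real_derivative
        \<Theta> * ((\<alpha> + 1/2) * s powr (\<alpha> - 1/2)) / b - (\<alpha> + 1/2) * (\<Theta> * s powr (\<alpha> - 3/2))) (at s)"
      unfolding enthalpy_def
      by (intro DERIV_diff DERIV_cdivide DERIV_cmult flux_deriv f_deriv s)
    show "((\<lambda>s. P s / b - h s) has_real_derivative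
        \<Theta> * (\<alpha> + 1/2) * s powr (\<alpha> - 3/2) * (s / b - 1)) (at s)"
      using d unfolding e by (rule DERIV_cong) (use assms in \<open>simp add: field_simps\<close>)
  next
    fix s :: real assume "0 < s" "s \<le> b"
    then show "\<Theta> * (\<alpha> + 1/2) * s powr (\<alpha> - 3/2) * (s / b - 1) \<le> 0"
      using Theta_pos alpha_ge by (intro mult_nonneg_nonpos) (auto simp: divide_simps)
  next
    fix s :: real assume "b \<le> s"
    then show "0 \<le> \<Theta> * (\<alpha> + 1/2) * s powr (\<alpha> - 3/2) * (s / b - 1)"
      using Theta_pos alpha_ge assms by (intro mult_nonneg_nonneg) (auto simp: divide_simps)
  qed
  then show ?thesis by (simp add: diff_divide_distrib)
qed

text \<open>
  As a function of the specific volume \<open>1 / s\<close>, the entropy density is convex with derivative \<open>- P s\<close>.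
\<close>
lemma f_tangent:
  assumes "0 < z" "0 < s"
  shows "f z - P z * (1 / s - 1 / z) \<le> f s"
proof -
  \<comment> \<open>Since \<open>f' s = P s / s\<^sup>2\<close>, the derivative of the right-hand side changes sign at \<open>z\<close>.\<close>
  have "f z + P z / z \<le> f s + P z / s"
  proof (rule min_at_sign_change[OF _ _ _ assms, where h' = "\<lambda>s. (P s - P z) / s\<^sup>2"])
    fix s :: real assume s: "0 < s"
    have e: "s powr (\<alpha> - 3/2) = s powr (\<alpha> + 1/2) / s\<^sup>2"
      using s powr_diff[of s "\<alpha> + 1/2" 2] by simp
    have d1: "((\<lambda>s. P z / s) has_real_derivative - (P z / s\<^sup>2)) (at s)"
      using s by (auto intro!: derivative_eq_intros simp: power2_eq_square)
    show "((\<lambda>s. f s + P z / s) has_real_derivative (P s - P z) / s\<^sup>2) (at s)"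
      using DERIV_add[OF f_deriv[OF s] d1] unfolding e flux_def by (simp add: diff_divide_distrib)
  next
    fix s :: real assume "0 < s" "s \<le> z"
    then show "(P s - P z) / s\<^sup>2 \<le> 0" using flux_mono[of s z]
      by (simp add: divide_nonpos_nonneg)
  next
    fix s :: real assume "z \<le> s"
    then show "0 \<le> (P s - P z) / s\<^sup>2" using flux_mono[of z s] assms by simp
  qed
  then show ?thesis by (simp add: right_diff_distrib)
qed

lemma hinv_enthalpy: 
  assumes "0 < s" shows "hinv (h s) = s"
proof (cases "\<alpha> = 1/2")
  case True
  have Th: "\<Theta> = 1/2" unfolding Theta_const_def True by simp
  have T: "2 * h s = ln s" using True by (simp add: enthalpy_def f_ent_def Th)
  have "hinv (h s) = exp (2 * h s)" using True by (simp add: enthalpy_inv_def)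
  then show ?thesis using assms T by simp
next
  case False
  with alpha_ge have a: "1/2 < \<alpha>" by simp
  have "(2 * \<alpha> - 1) / sqrt (2 * \<alpha>) * h s = s powr (\<alpha> - 1/2)"
    using a False by (simp add: enthalpy_def f_ent_def Theta_const_def divide_simps) (simp add: algebra_simps)
  then show ?thesis using a assms
    by (simp add: enthalpy_inv_def powr_powr)
qed

lemma hinv_nonneg [simp]: "0 \<le> hinv y" by (simp add: enthalpy_inv_def)

lemma hinv_mono: "y \<le> y' \<Longrightarrow> hinv y \<le> hinv y'"
  using alpha_ge by (auto simp: enthalpy_inv_def intro!: powr_mono2 max.mono divide_right_mono mult_left_mono)

text \<open>
  For \<open>\<alpha> > 1/2\<close> the inverse is a power with exponent \<open>1 / (\<alpha> - 1/2) \<ge> 2\<close> of the positive part, so it is differentiable at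
  the edge of its support and Lipschitz on every left half line.
\<close>
lemma hinv_lipschitz: "\<exists>C\<ge>0. \<forall>y\<le>Y. \<forall>y'\<le>Y. \<bar>hinv y - hinv y'\<bar> \<le> C * \<bar>y - y'\<bar>"
proof (cases "\<alpha> = 1/2")
  case True
  have "\<bar>exp (2 * y) - exp (2 * y')\<bar> \<le> 2 * exp (2 * Y) * \<bar>y - y'\<bar>" if "y \<le> Y" "y' \<le> Y" for y y'
  proof -
    have "norm (exp (2 * y) - exp (2 * y')) \<le> (2 * exp (2 * Y)) * norm (y - y')"
      by (rule field_differentiable_bound[of "{..Y}" "\<lambda>y. exp (2 * y)" "\<lambda>y. 2 * exp (2 * y)"])
         (use that in \<open>auto intro!: derivative_eq_intros\<close>)
    then show ?thesis by simp
  qed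
  then show ?thesis using True by (intro exI[of _ "2 * exp (2 * Y)"]) (simp add: enthalpy_inv_def)
next
  case False
  with alpha_ge have a: "1/2 < \<alpha>" by simp
  define q where "q = 1 / (\<alpha> - 1/2)"
  have q: "1 \<le> q" using a alpha_le by (simp add: q_def divide_simps)
  define k where "k = (2 * \<alpha> - 1) / sqrt (2 * \<alpha>)"
  have k: "0 < k" using a by (simp add: k_def)
  define M where "M = max 0 (k * Y)"
  have pl: "\<bar>s powr q - t powr q\<bar> \<le> q * M powr (q - 1) * \<bar>s - t\<bar>" if st: "0 \<le> t" "t \<le> s" "s \<le> M" for s t
  proof (cases "t = s")
    case False
    then have ts: "t < s" using st by simp
    have "continuous_on {t..s} (\<lambda>s. s powr q)"
      using q st by (intro continuous_on_powr' continuous_intros) auto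
    moreover have "((\<lambda>s. s powr q) has_derivative (*) (q * x powr (q - 1))) (at x)" if "t < x" "x < s" for x
      using has_real_derivative_powr[of x q] that st by (simp add: has_field_derivative_def)
    ultimately obtain x where x: "t < x" "x < s" "s powr q - t powr q = q * x powr (q - 1) * (s - t)"
      using mvt[OF ts, of "\<lambda>s. s powr q" "\<lambda>x. (*) (q * x powr (q - 1))"] by blast
    have "x powr (q - 1) \<le> M powr (q - 1)" using x st q by (intro powr_mono2) auto
    then have "q * x powr (q - 1) * (s - t) \<le> q * M powr (q - 1) * (s - t)"
      using q ts by (intro mult_right_mono mult_left_mono) auto
    moreover have "0 \<le> s powr q - t powr q" using ts st q by (simp add: powr_mono2)
    ultimately show ?thesis using x ts by simp
  qed simp
  have pl': "\<bar>s powr q - t powr q\<bar> \<le> q * M powr (q - 1) * \<bar>s - t\<bar>"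
    if "0 \<le> t" "t \<le> M" "0 \<le> s" "s \<le> M" for s t
    using pl[of t s] pl[of s t] that by (cases "t \<le> s") (auto simp: abs_minus_commute)
  have "\<bar>hinv y - hinv y'\<bar> \<le> q * M powr (q - 1) * k * \<bar>y - y'\<bar>" if "y \<le> Y" "y' \<le> Y" for y y'
  proof -
    have e: "hinv y = max 0 (k * y) powr q" for y using False by (simp add: enthalpy_inv_def k_def q_def)
    have "\<bar>hinv y - hinv y'\<bar> \<le> q * M powr (q - 1) * \<bar>max 0 (k * y) - max 0 (k * y')\<bar>"
      unfolding e M_def[symmetric] by (rule pl') (use that k in \<open>auto simp: M_def intro!: max.coboundedI2\<close>)
    also have "\<dots> \<le> q * M powr (q - 1) * \<bar>k * y - k * y'\<bar>"
      using q by (intro mult_left_mono) (auto simp: max_def)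
    also have "\<bar>k * y - k * y'\<bar> = k * \<bar>y - y'\<bar>" using k by (simp add: abs_mult flip: right_diff_distrib)
    finally show ?thesis by (simp add: mult.assoc)
  qed
  then show ?thesis using q k by (intro exI[of _ "q * M powr (q - 1) * k"]) simp
qed

lemma profile_eq_B: "profile \<alpha> lam (amplitude \<alpha> c) = B c"
proof
  fix x show "profile \<alpha> lam (amplitude \<alpha> c) x = B c x"
  proof (cases "\<alpha> = 1/2")
    case True then show ?thesis
      by (simp add: profile_def amplitude_def level_profile_def enthalpy_inv_def right_diff_distrib flip: exp_add)
  next
    case False
    have "(2 * \<alpha> - 1) / sqrt (2 * \<alpha>) * c - (\<alpha> - 1/2) / sqrt (2 * \<alpha>) * \<Lambda> * x\<^sup>2 =
        (2 * \<alpha> - 1) / sqrt (2 * \<alpha>) * (c - \<Lambda> / 2 * x\<^sup>2)"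
      using alpha_ge by (simp add: divide_simps) (simp add: algebra_simps)
    then show ?thesis using False
      by (simp add: profile_def amplitude_def level_profile_def enthalpy_inv_def)
  qed
qed

lemma isCont_hinv: "isCont hinv y"
proof -
  obtain C where C: "C \<ge> 0" "\<And>a b. a \<le> y + 1 \<Longrightarrow> b \<le> y + 1 \<Longrightarrow> \<bar>hinv a - hinv b\<bar> \<le> C * \<bar>a - b\<bar>"
    using hinv_lipschitz[of "y + 1"] by blast
  have "\<forall>\<^sub>F t in at y. t < y + 1" by (rule order_tendstoD(2)[OF tendsto_ident_at]) simp
  then have "\<forall>\<^sub>F t in at y. norm (hinv t - hinv y) \<le> C * \<bar>t - y\<bar>"
    by eventually_elim (use C(2) in auto)
  moreover have "((\<lambda>t. C * \<bar>t - y\<bar>) \<longlongrightarrow> 0) (at y)" by (auto intro!: tendsto_eq_intros)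
  ultimately have "((\<lambda>t. hinv t - hinv y) \<longlongrightarrow> 0) (at y)"
    by (rule Lim_null_comparison)
  then show ?thesis unfolding isCont_def by (rule LIM_zero_cancel)
qed

lemma continuous_B: "continuous_on UNIV (B c)"
proof -
  have "continuous_on UNIV hinv" using isCont_hinv by (simp add: continuous_on_eq_continuous_at)
  moreover have "continuous_on UNIV (\<lambda>s::real. c - \<Lambda> / 2 * s\<^sup>2)"
    by (intro continuous_on_diff continuous_on_mult continuous_on_power continuous_on_const continuous_on_id)
  ultimately show ?thesis unfolding level_profile_def[abs_def]
    by (rule continuous_on_compose2) simp
qed

lemma B_nonneg [simp]: "0 \<le> B c s" by (simp add: level_profile_def)

lemma B_le_peak: "B c s \<le> hinv c"
  unfolding level_profile_def by (rule hinv_mono) (use Lambda_pos in simp)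

lemma B_mono: "c \<le> c' \<Longrightarrow> B c s \<le> B c' s"
  unfolding level_profile_def by (rule hinv_mono) simp

lemma borel_B [measurable]: "B c \<in> borel_measurable borel"
  by (rule borel_measurable_continuous_onI[OF continuous_B])

text \<open>
  A multiple of a normal density for \<open>\<alpha> = 1/2\<close>, bounded with compact support otherwise.
\<close>
lemma integrable_B: "integrable lborel (B c)"
proof (cases "\<alpha> = 1/2")
  case True
  define \<sigma> where "\<sigma> = sqrt (1 / (2 * \<Lambda>))"
  have s: "0 < \<sigma>" using Lambda_pos unfolding \<sigma>_def by (intro real_sqrt_gt_zero divide_pos_pos mult_pos_pos) auto
  have s2: "2 * \<sigma>\<^sup>2 = 1 / \<Lambda>"
    using Lambda_pos unfolding \<sigma>_def by (subst real_sqrt_pow2) auto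
  have "integrable lborel (\<lambda>x. (exp (2 * c) * sqrt (2 * pi * \<sigma>\<^sup>2)) * normal_density 0 \<sigma> x)"
    by (intro integrable_mult_right integrable_normal_density s)
  also have "(\<lambda>x. (exp (2 * c) * sqrt (2 * pi * \<sigma>\<^sup>2)) * normal_density 0 \<sigma> x) = B c"
  proof
    fix x
    have "- x\<^sup>2 / (2 * \<sigma>\<^sup>2) = - (\<Lambda> * x\<^sup>2)" unfolding s2 by simp
    moreover have "sqrt (2 * pi * \<sigma>\<^sup>2) \<noteq> 0" using s by simp
    ultimately show "(exp (2 * c) * sqrt (2 * pi * \<sigma>\<^sup>2)) * normal_density 0 \<sigma> x = B c x"
      unfolding level_profile_def enthalpy_inv_def if_P[OF True] normal_density_def
      by (simp add: right_diff_distrib flip: exp_add)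
  qed
  finally show ?thesis .
next
  case False
  define R where "R = sqrt (2 * max 0 c / \<Lambda>)"
  have "integrable lborel (\<lambda>x. hinv c * indicator {-R..R} x)"
    by (intro integrable_mult_right integrable_real_indicator) (auto simp: emeasure_lborel_Icc_eq)
  then show ?thesis
  proof (rule Bochner_Integration.integrable_bound)
    show "AE x in lborel. norm (B c x) \<le> norm (hinv c * indicator {-R..R} x)"
    proof (intro AE_I2)
      fix x show "norm (B c x) \<le> norm (hinv c * indicator {-R..R} x)"
      proof (cases "x \<in> {-R..R}")
        case True then show ?thesis using B_le_peak[of c x] by simp
      next
        case F: False
        then have "R < \<bar>x\<bar>" by auto
        then have "2 * max 0 c / \<Lambda> < \<bar>x\<bar>\<^sup>2"
          unfolding R_def by (metis real_sqrt_abs2 real_sqrt_less_iff power2_eq_square abs_mult_self_eq)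
        then have "2 * max 0 c < x\<^sup>2 * \<Lambda>" using Lambda_pos by (simp add: pos_divide_less_eq)
        then have "c - \<Lambda> / 2 * x\<^sup>2 \<le> 0" by (simp add: mult.commute)
        then have "hinv (c - \<Lambda> / 2 * x\<^sup>2) \<le> hinv 0" by (rule hinv_mono)
        also have "hinv 0 = 0" using False by (simp add: enthalpy_inv_def)
        finally have "B c x \<le> 0" by (simp add: level_profile_def)
        then have "B c x = 0" using B_nonneg[of c x] by linarith
        then show ?thesis by simp
      qed
    qed
  qed simp
qed

end

section \<open>Existence, uniqueness and equilibrium equations of the discrete minimizer\<close>

lemma sum_by_parts:
  fixes p h :: "nat \<Rightarrow> real"
  shows "(\<Sum>k = 1..n. p k * (h k - h (k - 1))) =
    (\<Sum>k = 0..n. h k * (p k - p (Suc k))) + h n * p (Suc n) - h 0 * p 0"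
  by (induction n) (auto simp: algebra_simps)

lemma strict_mono_on_steps:
  fixes x :: "nat \<Rightarrow> real"
  assumes "\<And>k. k < K \<Longrightarrow> x k < x (Suc k)"
  shows "strict_mono_on {0..K} x"
proof (rule strict_mono_onI)
  fix r t assume "r \<in> {0..K}" "t \<in> {0..K}" "r < t"
  have "t \<le> K \<longrightarrow> x r < x t" using \<open>r < t\<close>
  proof (induction t)
    case (Suc t)
    show ?case
    proof
      assume "Suc t \<le> K"
      then have "x t < x (Suc t)" using assms[of t] by simp
      moreover have "x r \<le> x t" using Suc \<open>Suc t \<le> K\<close> by (cases "r = t") auto
      ultimately show "x r < x (Suc t)" by simp
    qed
  qed simp
  then show "x r < x t" using \<open>t \<in> {0..K}\<close> by simp
qed

lemma configs_iff:
  "x \<in> configs K \<longleftrightarrow> x \<in> extensional {0..K} \<and> (\<forall>k\<in>{1..K}. x (k - 1) < x k)"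
proof
  assume "x \<in> configs K"
  then show "x \<in> extensional {0..K} \<and> (\<forall>k\<in>{1..K}. x (k - 1) < x k)"
    by (auto simp: configs_def PiE_def strict_mono_on_def)
next
  assume x: "x \<in> extensional {0..K} \<and> (\<forall>k\<in>{1..K}. x (k - 1) < x k)"
  have "x k < x (Suc k)" if "k < K" for k
    using conjunct2[OF x, rule_format, of "Suc k"] that by simp
  then show "x \<in> configs K"
    using x strict_mono_on_steps[of K x] by (auto simp: configs_def PiE_def)
qed

lemma configs_step: "x \<in> configs K \<Longrightarrow> k \<in> {1..K} \<Longrightarrow> x (k - 1) < x k"
  unfolding configs_iff by blast

lemma zval_pos:
  assumes "x \<in> configs K" "k \<in> {1..K}"
  shows "0 < zval K x k"
  using assms by (auto simp: zval_def configs_iff delta_def intro!: divide_pos_pos)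

lemma inverse_zval:
  assumes "k \<in> {1..K}"
  shows "1 / zval K x k = real K * (x k - x (k - 1))"
  using assms by (simp add: zval_def delta_def)

lemma zval_outside [simp]: "zval K x 0 = 0" "zval K x (Suc K) = 0"
  by (auto simp: zval_def)

context entropy_params
begin

text \<open>
  The partial derivative of the entropy in the direction of \<open>x k\<close>.
\<close>
definition gradient :: "nat \<Rightarrow> (nat \<Rightarrow> real) \<Rightarrow> nat \<Rightarrow> real" where
  "gradient K x k = \<Lambda> * delta K * x k - (P (zval K x k) - P (zval K x (Suc k)))"

text \<open>
  The entropy is uniformly convex: the cell terms are convex by \<open>f_tangent\<close>, and the confinement term is quadratic. Summation by
  parts moves the differences of \<open>y - x\<close> onto the fluxes, which produces the gradient.
\<close>
lemma H_above_tangent: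
  assumes x: "x \<in> configs K" and y: "y \<in> configs K"
  shows "H_ent \<alpha> lam K x + (\<Sum>k = 0..K. (y k - x k) * gradient K x k)
      + \<Lambda> / 2 * delta K * (\<Sum>k = 0..K. (y k - x k)\<^sup>2) \<le> H_ent \<alpha> lam K y"
proof -
  define p where "p k = P (zval K x k)" for k
  define g where "g k = y k - x k" for k
  have "delta K * f (zval K x k) - p k * (g k - g (k - 1)) \<le> delta K * f (zval K y k)"
    if k: "k \<in> {1..K}" for k
  proof -
    have K: "0 < delta K" "delta K * real K = 1" using k by (auto simp: delta_def)
    have "f (zval K x k) - p k * (1 / zval K y k - 1 / zval K x k) \<le> f (zval K y k)"
      unfolding p_def by (rule f_tangent) (use zval_pos x y k in auto)
    then have "f (zval K x k) - p k * (real K * (g k - g (k - 1))) \<le> f (zval K y k)"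
      unfolding inverse_zval[OF k] g_def by (simp add: algebra_simps)
    then have "delta K * (f (zval K x k) - p k * (real K * (g k - g (k - 1)))) \<le> delta K * f (zval K y k)"
      using K by (intro mult_left_mono) auto
    moreover have "delta K * (p k * (real K * (g k - g (k - 1)))) = (delta K * real K) * (p k * (g k - g (k - 1)))"
      by simp
    ultimately show ?thesis using K by (simp add: right_diff_distrib)
  qed
  then have "(\<Sum>k = 1..K. delta K * f (zval K x k) - p k * (g k - g (k - 1))) \<le> (\<Sum>k = 1..K. delta K * f (zval K y k))"
    by (intro sum_mono) auto
  then have 1: "delta K * (\<Sum>k = 1..K. f (zval K x k)) - (\<Sum>k = 0..K. g k * (p k - p (Suc k)))
      \<le> delta K * (\<Sum>k = 1..K. f (zval K y k))"
    unfolding sum_subtractf sum_by_parts by (simp add: p_def sum_distrib_left)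
  have "(\<Sum>k = 0..K. \<Lambda> / 2 * delta K * \<bar>y k\<bar>\<^sup>2) = (\<Sum>k = 0..K. \<Lambda> / 2 * delta K * \<bar>x k\<bar>\<^sup>2
      + \<Lambda> * delta K * (g k * x k) + \<Lambda> / 2 * delta K * (g k)\<^sup>2)"
    by (intro sum.cong) (auto simp: g_def power2_eq_square algebra_simps)
  then have 2: "\<Lambda> / 2 * delta K * (\<Sum>k = 0..K. \<bar>y k\<bar>\<^sup>2) = \<Lambda> / 2 * delta K * (\<Sum>k = 0..K. \<bar>x k\<bar>\<^sup>2)
      + (\<Sum>k = 0..K. \<Lambda> * delta K * (g k * x k)) + \<Lambda> / 2 * delta K * (\<Sum>k = 0..K. (g k)\<^sup>2)"
    by (simp only: sum.distrib sum_distrib_left)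
  have 3: "(\<Sum>k = 0..K. g k * gradient K x k) =
      (\<Sum>k = 0..K. \<Lambda> * delta K * (g k * x k)) - (\<Sum>k = 0..K. g k * (p k - p (Suc k)))"
    unfolding sum_subtractf[symmetric] by (intro sum.cong) (auto simp: gradient_def p_def algebra_simps)
  show ?thesis using 1 2 3 unfolding H_ent_def g_def by linarith
qed

text \<open>
  Moving \<open>x k\<close> by a small \<open>t\<close> gives an admissible \<open>y t\<close>. The tangent inequality at \<open>y t\<close> and minimality at \<open>x\<close> force
  \<open>t * gradient K (y t) k \<ge> 0\<close>; as \<open>t\<close> tends to 0 from either side, the gradient at \<open>x\<close> is both nonnegative and nonpositive.
\<close>
lemma minimizer_gradient_zero:
  assumes x: "x \<in> configs K" and min: "\<And>y. y \<in> configs K \<Longrightarrow> H_ent \<alpha> lam K x \<le> H_ent \<alpha> lam K y"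
    and k: "k \<le> K" and K: "0 < K"
  shows "gradient K x k = 0"
proof -
  define y where "y t = x(k := x k + t)" for t :: real
  have y_lim: "((\<lambda>t. y t i) \<longlongrightarrow> x i) (at 0)" for i
    by (cases "i = k") (auto simp: y_def intro!: tendsto_eq_intros)
  have "\<forall>\<^sub>F t in at 0. \<forall>i\<in>{1..K}. y t (i - 1) < y t i"
  proof (rule eventually_ball_finite)
    show "\<forall>i\<in>{1..K}. \<forall>\<^sub>F t in at 0. y t (i - 1) < y t i"
    proof
      fix i assume i: "i \<in> {1..K}"
      have "((\<lambda>t. y t i - y t (i - 1)) \<longlongrightarrow> x i - x (i - 1)) (at 0)"
        by (intro tendsto_intros y_lim)
      moreover have "0 < x i - x (i - 1)" using configs_step[OF x i] by simp
      ultimately have "\<forall>\<^sub>F t in at 0. 0 < y t i - y t (i - 1)" by (rule order_tendstoD(1))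
      then show "\<forall>\<^sub>F t in at 0. y t (i - 1) < y t i" by simp
    qed
  qed simp
  moreover have "y t \<in> extensional {0..K}" for t
    using x k by (auto simp: y_def configs_iff extensional_def)
  ultimately have y_cfg: "\<forall>\<^sub>F t in at 0. y t \<in> configs K" by (auto simp: configs_iff)
  have y_sign: "\<forall>\<^sub>F t in at 0. 0 \<le> t * gradient K (y t) k"
    using y_cfg
  proof eventually_elim
    case (elim t)
    have "(\<Sum>i = 0..K. (x i - y t i) * gradient K (y t) i) = (\<Sum>i = 0..K. if i = k then - t * gradient K (y t) k else 0)"
      by (intro sum.cong) (auto simp: y_def)
    then have "(\<Sum>i = 0..K. (x i - y t i) * gradient K (y t) i) = - t * gradient K (y t) k" using k by simp
    moreover have "0 \<le> \<Lambda> / 2 * delta K * (\<Sum>i = 0..K. (x i - y t i)\<^sup>2)"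
      using Lambda_pos by (intro mult_nonneg_nonneg sum_nonneg) (auto simp: delta_def)
    ultimately show ?case using H_above_tangent[OF elim x] min[OF elim] by linarith
  qed
  have z_lim: "((\<lambda>t. P (zval K (y t) i)) \<longlongrightarrow> P (zval K x i)) (at 0)" for i
  proof (cases "i \<in> {1..K}")
    case True
    have "x i - x (i - 1) \<noteq> 0" using configs_step[OF x True] by simp
    then have "((\<lambda>t. zval K (y t) i) \<longlongrightarrow> zval K x i) (at 0)"
      using True unfolding zval_def by (auto intro!: tendsto_intros y_lim)
    moreover have "isCont P (zval K x i)"
      using flux_deriv[OF zval_pos[OF x True]] by (rule DERIV_isCont)
    ultimately show ?thesis by (rule isCont_tendsto_compose[rotated])
  next
    case False
    then show ?thesis by (auto simp: zval_def)
  qed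
  have g_lim: "((\<lambda>t. gradient K (y t) k) \<longlongrightarrow> gradient K x k) (at 0)"
    unfolding gradient_def by (intro tendsto_intros y_lim z_lim)
  have "0 \<le> gradient K x k"
  proof (rule tendsto_lowerbound)
    show "((\<lambda>t. gradient K (y t) k) \<longlongrightarrow> gradient K x k) (at_right 0)"
      using g_lim by (rule filterlim_mono) (auto simp: at_within_le_at)
    have "\<forall>\<^sub>F t in at_right 0. 0 \<le> t * gradient K (y t) k"
      using y_sign by (rule filter_leD[OF at_le, rotated]) simp
    then show "\<forall>\<^sub>F t in at_right 0. 0 \<le> gradient K (y t) k"
      using eventually_at_right_less[of 0] by eventually_elim (simp add: zero_le_mult_iff)
  qed simp
  moreover have "gradient K x k \<le> 0"
  proof (rule tendsto_upperbound)
    show "((\<lambda>t. gradient K (y t) k) \<longlongrightarrow> gradient K x k) (at_left 0)"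
      using g_lim by (rule filterlim_mono) (auto simp: at_within_le_at)
    have "\<forall>\<^sub>F t in at_left 0. 0 \<le> t * gradient K (y t) k"
      using y_sign by (rule filter_leD[OF at_le, rotated]) simp
    moreover have "\<forall>\<^sub>F t in at_left (0::real). t < 0" by (simp add: eventually_at_filter)
    ultimately show "\<forall>\<^sub>F t in at_left 0. gradient K (y t) k \<le> 0"
      by eventually_elim (simp add: zero_le_mult_iff)
  qed simp
  ultimately show ?thesis by simp
qed

lemma f_lower_bound: "0 < s \<Longrightarrow> - \<Theta> / s \<le> f s"
proof -
  assume s: "0 < s"
  have "0 \<le> f 1" using alpha_ge Theta_pos by (auto simp: f_ent_def)
  then show ?thesis using f_tangent[of 1 s] s Theta_pos by (simp add: flux_def right_diff_distrib)
qed

text \<open>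
  The entropy density is at least \<open>- \<Theta> / s\<close>, so the cell terms are bounded below by a linear function of the length \<open>x K - x 0\<close> and the
  quadratic term controls the positions. Once the positions are bounded, the entropy bounds each density from above and thus each gap
  from below.
\<close>
lemma H_coercive:
  assumes K: "0 < K"
  obtains R \<epsilon> where "0 < \<epsilon>" and
    "\<And>y k. y \<in> configs K \<Longrightarrow> H_ent \<alpha> lam K y \<le> E \<Longrightarrow> k \<le> K \<Longrightarrow> \<bar>y k\<bar> \<le> R"
    "\<And>y k. y \<in> configs K \<Longrightarrow> H_ent \<alpha> lam K y \<le> E \<Longrightarrow> k \<in> {1..K} \<Longrightarrow> y (k - 1) + \<epsilon> \<le> y k"
proof -
  have d: "0 < delta K" "delta K * real K = 1" using K by (auto simp: delta_def)
  define a where "a = \<Lambda> / 2 * delta K"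
  have a: "0 < a" using d Lambda_pos by (simp add: a_def)
  \<comment> \<open>Beyond \<open>R\<close> the quadratic \<open>a r\<^sup>2 - 2 \<Theta> r\<close> exceeds \<open>E\<close>.\<close>
  define R where "R = 1 + (2 * \<Theta> + \<bar>E\<bar>) / a"
  define Z where "Z = 1 + hinv ((\<alpha> + 1/2) * ((E + 2 * \<Theta> * R) / delta K))"
  have Z: "0 < Z" by (simp add: Z_def add_pos_nonneg)
  have lower: "- \<Theta> * (y K - y 0) \<le> (\<Sum>k = 1..K. delta K * f (zval K y k))"
    "\<And>k. k \<in> {1..K} \<Longrightarrow> delta K * f (zval K y k) - \<Theta> * (y K - y 0) \<le> (\<Sum>k = 1..K. delta K * f (zval K y k))"
    if y: "y \<in> configs K" for y
  proof -
    have summand: "- \<Theta> * (y k - y (k - 1)) \<le> delta K * f (zval K y k)" if k: "k \<in> {1..K}" for k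
    proof -
      have "- \<Theta> * (1 / zval K y k) \<le> f (zval K y k)" using f_lower_bound[OF zval_pos[OF y k]] by simp
      then have "delta K * (- \<Theta> * (real K * (y k - y (k - 1)))) \<le> delta K * f (zval K y k)"
        unfolding inverse_zval[OF k] using d by (intro mult_left_mono) auto
      moreover have "delta K * (- \<Theta> * (real K * (y k - y (k - 1)))) = (delta K * real K) * (- \<Theta> * (y k - y (k - 1)))"
        by (simp only: mult_ac)
      ultimately show ?thesis by (simp only: d mult_1_left)
    qed
    have tele: "(\<Sum>k = 1..K. - \<Theta> * (y k - y (k - 1))) = - \<Theta> * (y K - y 0)"
      unfolding sum_distrib_left[symmetric] by (induction K) auto
    show "- \<Theta> * (y K - y 0) \<le> (\<Sum>k = 1..K. delta K * f (zval K y k))"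
      unfolding tele[symmetric] by (rule sum_mono[OF summand])
    fix k assume k: "k \<in> {1..K}"
    have "(\<Sum>k\<in>{1..K} - {k}. - \<Theta> * (y k - y (k - 1))) \<le> (\<Sum>k\<in>{1..K} - {k}. delta K * f (zval K y k))"
      by (rule sum_mono) (use summand in auto)
    moreover have "- \<Theta> * (y k - y (k - 1)) \<le> 0"
      using configs_step[OF y k] Theta_pos by simp
    ultimately show "delta K * f (zval K y k) - \<Theta> * (y K - y 0) \<le> (\<Sum>k = 1..K. delta K * f (zval K y k))"
      using tele sum.remove[of "{1..K}" k "\<lambda>k. - \<Theta> * (y k - y (k - 1))"]
        sum.remove[of "{1..K}" k "\<lambda>k. delta K * f (zval K y k)"] k by simp
  qed
  have bound: "\<bar>y k\<bar> \<le> R" if y: "y \<in> configs K" "H_ent \<alpha> lam K y \<le> E" and k: "k \<le> K" for y k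
  proof -
    define N where "N = (\<Sum>k = 0..K. (y k)\<^sup>2)"
    define r where "r = sqrt N"
    have r: "\<bar>y k\<bar> \<le> r" if "k \<le> K" for k
    proof -
      have "(y k)\<^sup>2 \<le> N" unfolding N_def by (rule member_le_sum) (use that in auto)
      then show ?thesis unfolding r_def by (rule real_le_rsqrt[of "\<bar>y k\<bar>", simplified])
    qed
    have N: "N = r\<^sup>2" by (simp add: r_def N_def sum_nonneg)
    have "a * N - \<Theta> * (y K - y 0) \<le> E"
      using y(2) lower(1)[OF y(1)] by (simp add: H_ent_def a_def N_def sum_distrib_left)
    moreover have "\<Theta> * (y K - y 0) \<le> \<Theta> * (2 * r)"
      using r[of K] r[of 0] Theta_pos by (intro mult_left_mono) auto
    ultimately have r2: "a * r * r - \<Theta> * (2 * r) \<le> E" unfolding N by (simp add: power2_eq_square)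
    have "r \<le> R"
    proof (cases "r \<le> 1")
      case True
      have "0 \<le> (2 * \<Theta> + \<bar>E\<bar>) / a" using a Theta_pos by simp
      then show ?thesis using True by (simp add: R_def)
    next
      case False
      then have "\<bar>E\<bar> * 1 \<le> \<bar>E\<bar> * r" by (intro mult_left_mono) auto
      then have "a * r * r - \<Theta> * (2 * r) \<le> \<bar>E\<bar> * r" using r2 by linarith
      then have "(a * r) * r \<le> (2 * \<Theta> + \<bar>E\<bar>) * r" by (simp add: algebra_simps)
      then have "a * r \<le> 2 * \<Theta> + \<bar>E\<bar>" using False by (simp add: mult_le_cancel_right)
      then have "r \<le> (2 * \<Theta> + \<bar>E\<bar>) / a" using a by (simp add: pos_le_divide_eq mult.commute)
      then show ?thesis by (simp add: R_def)
    qed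
    then show ?thesis using r[OF k] by simp
  qed
  have gap: "y (k - 1) + delta K / Z \<le> y k"
    if y: "y \<in> configs K" "H_ent \<alpha> lam K y \<le> E" and k: "k \<in> {1..K}" for y k
  proof -
    have z: "0 < zval K y k" by (rule zval_pos[OF y(1) k])
    have "0 \<le> \<Lambda> / 2 * delta K * (\<Sum>k = 0..K. \<bar>y k\<bar>\<^sup>2)"
      using Lambda_pos d by (intro mult_nonneg_nonneg sum_nonneg) auto
    then have "delta K * f (zval K y k) - \<Theta> * (y K - y 0) \<le> E"
      using lower(2)[OF y(1) k] y(2) by (simp add: H_ent_def sum_distrib_left)
    moreover have "\<Theta> * (y K - y 0) \<le> \<Theta> * (2 * R)"
      using bound[OF y, of K] bound[OF y, of 0] Theta_pos by (intro mult_left_mono) auto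
    ultimately have "f (zval K y k) * delta K \<le> E + 2 * \<Theta> * R" by (simp add: algebra_simps)
    then have "f (zval K y k) \<le> (E + 2 * \<Theta> * R) / delta K" using d by (simp add: pos_le_divide_eq)
    then have "h (zval K y k) \<le> (\<alpha> + 1/2) * ((E + 2 * \<Theta> * R) / delta K)"
      unfolding enthalpy_def using alpha_ge by (intro mult_left_mono) auto
    from hinv_mono[OF this] have "zval K y k \<le> Z" using hinv_enthalpy[OF z] by (simp add: Z_def)
    then have "delta K / Z \<le> delta K / zval K y k" using z d by (intro divide_left_mono) auto
    also have "\<dots> = y k - y (k - 1)" using k d by (simp add: zval_def)
    finally show ?thesis by simp
  qed
  show thesis by (rule that[of "delta K / Z" R]) (use bound gap d Z in auto)
qed

lemma continuous_on_f: "continuous_on {0<..} f"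
  using f_deriv by (intro continuous_at_imp_continuous_on) (auto intro: DERIV_isCont)

text \<open>
  Sublevel sets lie in a set that is compact in the product topology and consists of configurations.
\<close>
lemma minimizer_exists:
  assumes K: "0 < K"
  shows "\<exists>x\<in>configs K. \<forall>y\<in>configs K. H_ent \<alpha> lam K x \<le> H_ent \<alpha> lam K y"
proof -
  define x0 :: "nat \<Rightarrow> real" where "x0 = restrict real {0..K}"
  have x0: "x0 \<in> configs K" by (auto simp: configs_iff x0_def)
  define E where "E = H_ent \<alpha> lam K x0"
  obtain R \<epsilon> where eps: "0 < \<epsilon>"
    and R: "\<And>y k. y \<in> configs K \<Longrightarrow> H_ent \<alpha> lam K y \<le> E \<Longrightarrow> k \<le> K \<Longrightarrow> \<bar>y k\<bar> \<le> R"
    and gap: "\<And>y k. y \<in> configs K \<Longrightarrow> H_ent \<alpha> lam K y \<le> E \<Longrightarrow> k \<in> {1..K} \<Longrightarrow> y (k - 1) + \<epsilon> \<le> y k"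
    using H_coercive[OF K] by metis
  define A :: "nat \<Rightarrow> real set" where "A i = (if i \<le> K then {-R..R} else {undefined})" for i
  define S where "S = PiE UNIV A \<inter> (\<Inter>k\<in>{1..K}. {x. x (k - 1) + \<epsilon> \<le> x k})"
  have coord: "continuous_on T (\<lambda>x::nat \<Rightarrow> real. x i)" for i T
    by (rule continuous_on_product_coordinates[THEN continuous_on_subset]) simp
  have "compactin (product_topology (\<lambda>i. euclidean) UNIV) (PiE UNIV A)"
    unfolding compactin_PiE by (auto simp: A_def)
  then have "compact (PiE UNIV A)"
    by (simp only: euclidean_product_topology compactin_euclidean_iff)
  moreover have "closed (\<Inter>k\<in>{1..K}. {x::nat \<Rightarrow> real. x (k - 1) + \<epsilon> \<le> x k})"
    by (intro closed_INT ballI closed_Collect_le continuous_intros coord)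
  ultimately have "compact S" unfolding S_def by (rule compact_Int_closed)
  have S_sub: "x \<in> configs K" if x: "x \<in> S" for x
  proof -
    have "x i = undefined" if "i \<notin> {0..K}" for i
    proof -
      have "x i \<in> A i" using x by (auto simp: S_def)
      then show ?thesis using that by (simp add: A_def)
    qed
    moreover have "x (k - 1) < x k" if "k \<in> {1..K}" for k
    proof -
      have "x (k - 1) + \<epsilon> \<le> x k" using x that unfolding S_def by blast
      then show ?thesis using eps by linarith
    qed
    ultimately show ?thesis by (auto simp: configs_iff extensional_def)
  qed
  have S_sup: "y \<in> S" if y: "y \<in> configs K" "H_ent \<alpha> lam K y \<le> E" for y
  proof -
    have "y i \<in> A i" for i
    proof (cases "i \<le> K")
      case True
      then show ?thesis using R[OF y True] by (auto simp: A_def abs_le_iff)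
    next
      case False
      then show ?thesis using y(1) by (auto simp: A_def configs_iff extensional_def)
    qed
    then show ?thesis using gap[OF y] by (auto simp: S_def)
  qed
  have "continuous_on S (H_ent \<alpha> lam K)"
  proof -
    have "continuous_on S (\<lambda>x. f (zval K x k))" if k: "k \<in> {1..K}" for k
    proof (rule continuous_on_compose2[OF continuous_on_f])
      have "x k - x (k - 1) \<noteq> 0" if "x \<in> S" for x
        using configs_step[OF S_sub[OF that] k] by simp
      then have "continuous_on S (\<lambda>x. delta K / (x k - x (k - 1)))"
        by (intro continuous_intros coord) auto
      then show "continuous_on S (\<lambda>x. zval K x k)" using k by (simp add: zval_def)
      show "(\<lambda>x. zval K x k) ` S \<subseteq> {0<..}" using zval_pos[OF S_sub k] by auto
    qed
    then show ?thesis unfolding H_ent_def by (intro continuous_intros coord) auto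
  qed
  moreover have "S \<noteq> {}" using S_sup[OF x0] by (auto simp: E_def)
  ultimately obtain x where x: "x \<in> S" "\<And>y. y \<in> S \<Longrightarrow> H_ent \<alpha> lam K x \<le> H_ent \<alpha> lam K y"
    using continuous_attains_inf[OF \<open>compact S\<close>] by metis
  have "H_ent \<alpha> lam K x \<le> H_ent \<alpha> lam K y" if "y \<in> configs K" for y
    using x(2)[OF S_sup[OF that]] x(2)[OF S_sup[OF x0]] by (cases "H_ent \<alpha> lam K y \<le> E") (auto simp: E_def)
  then show ?thesis using S_sub[OF x(1)] by blast
qed

text \<open>
  The equilibrium equations hold at every minimizer; conversely, the tangent inequality at such a point shows that there is no
  second minimizer, so the definite description denotes the minimizer.
\<close>
lemma x_min_steady:
  assumes K: "0 < K"
  shows "x_min \<alpha> lam K \<in> configs K"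
    and "\<And>k. k \<le> K \<Longrightarrow> P (zval K (x_min \<alpha> lam K) k) - P (zval K (x_min \<alpha> lam K) (Suc k))
      = \<Lambda> * delta K * x_min \<alpha> lam K k"
proof -
  obtain x where x: "x \<in> configs K" "\<And>y. y \<in> configs K \<Longrightarrow> H_ent \<alpha> lam K x \<le> H_ent \<alpha> lam K y"
    using minimizer_exists[OF K] by blast
  have grad: "gradient K x k = 0" if "k \<le> K" for k by (rule minimizer_gradient_zero[OF x that K])
  have "x_min \<alpha> lam K = x" unfolding x_min_def
  proof (rule the_equality)
    show "is_arg_min (H_ent \<alpha> lam K) (\<lambda>y. y \<in> configs K) x"
      using x by (auto simp: is_arg_min_linorder)
    fix y assume "is_arg_min (H_ent \<alpha> lam K) (\<lambda>y. y \<in> configs K) y"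
    then have y: "y \<in> configs K" "H_ent \<alpha> lam K y \<le> H_ent \<alpha> lam K x"
      using x by (auto simp: is_arg_min_linorder)
    have "\<Lambda> / 2 * delta K * (\<Sum>k = 0..K. (y k - x k)\<^sup>2) \<le> 0"
      using H_above_tangent[OF x(1) y(1)] y(2) grad by simp
    moreover have "0 < \<Lambda> / 2 * delta K" using Lambda_pos K by (simp add: delta_def)
    ultimately have "(\<Sum>k = 0..K. (y k - x k)\<^sup>2) \<le> 0"
      by (metis mult_pos_pos not_le)
    then have "(\<Sum>k = 0..K. (y k - x k)\<^sup>2) = 0" by (simp add: antisym sum_nonneg)
    then have "y k = x k" if "k \<le> K" for k using that by (simp add: sum_nonneg_eq_0_iff)
    then show "y = x" using x(1) y(1)
      by (intro extensionalityI[of _ "{0..K}"]) (auto simp: configs_iff)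
  qed
  then show "x_min \<alpha> lam K \<in> configs K"
    and "\<And>k. k \<le> K \<Longrightarrow> P (zval K (x_min \<alpha> lam K) k) - P (zval K (x_min \<alpha> lam K) (Suc k))
      = \<Lambda> * delta K * x_min \<alpha> lam K k"
    using x(1) grad by (simp_all add: gradient_def)
qed

end

section \<open>Energy estimates for discrete equilibria\<close>

text \<open>
  After division by \<open>a\<close> this says \<open>t\<^sup>q + (1 - t)\<^sup>q \<le> 1\<close> on the unit interval.
\<close>
lemma powr_diff_superadditive:
  fixes q :: real
  assumes "1 \<le> q" "0 \<le> b" "b \<le> a"
  shows "(a - b) powr q \<le> a powr q - b powr q"
proof (cases "a = b")
  case False
  then have a: "0 < a" using assms by simp
  have le: "t powr q \<le> t" if "0 \<le> t" "t \<le> 1" for t :: real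
    using powr_mono'[of 1 q t] assms that by simp
  have eq: "a powr q * (t / a) powr q = t powr q" if "0 \<le> t" for t
    using a that by (simp add: powr_divide)
  have "((a - b) / a) powr q + (b / a) powr q \<le> (a - b) / a + b / a"
    using a assms by (intro add_mono le) auto
  also have "\<dots> = 1" using a by (simp add: divide_simps)
  finally have "a powr q * (((a - b) / a) powr q + (b / a) powr q) \<le> a powr q * 1"
    by (intro mult_left_mono) auto
  then show ?thesis using eq[of "a - b"] eq[of b] assms by (simp add: distrib_left)
qed (use assms in simp)

context entropy_params
begin

lemma Theta_powr_diff_le_flux_diff:
  assumes "0 \<le> b" "b \<le> a"
  shows "\<Theta> * (a - b) powr (\<alpha> + 1/2) \<le> P a - P b"
  unfolding flux_def right_diff_distrib[symmetric]
  using Theta_pos alpha_ge assms by (intro mult_left_mono powr_diff_superadditive) auto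

text \<open>
  A modulus of continuity for the inverse of the flux that is uniform down to \<open>s = 0\<close>.
\<close>
lemma abs_diff_le_of_flux_diff:
  assumes "0 \<le> a" "0 \<le> b" "\<bar>P a - P b\<bar> \<le> e"
  shows "\<bar>a - b\<bar> \<le> (e / \<Theta>) powr (1 / (\<alpha> + 1/2))"
proof -
  have main: "a - b \<le> (e / \<Theta>) powr (1 / (\<alpha> + 1/2))" if "0 \<le> b" "b \<le> a" "P a - P b \<le> e" for a b
  proof -
    have "(a - b) powr (\<alpha> + 1/2) \<le> e / \<Theta>"
      using Theta_powr_diff_le_flux_diff[of b a] that Theta_pos by (simp add: pos_le_divide_eq mult.commute)
    then have "((a - b) powr (\<alpha> + 1/2)) powr (1 / (\<alpha> + 1/2)) \<le> (e / \<Theta>) powr (1 / (\<alpha> + 1/2))"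
      using alpha_ge by (intro powr_mono2) auto
    then show ?thesis using alpha_ge that by (simp add: powr_powr)
  qed
  show ?thesis
    using main[of b a] main[of a b] assms by (cases "b \<le> a") (auto simp: abs_minus_commute)
qed

text \<open>
  Bounds, independent of \<open>K\<close>, for the largest cell density of an equilibrium: \<open>peak_min_le\<close> and \<open>le_peak_max\<close> below.
\<close>
definition peak_min :: real where "peak_min = min 1 (\<Lambda> / (32 * \<Theta>))"
definition peak_max :: real where "peak_max = 1 + 4 * \<Lambda> / \<Theta>"

text \<open>
  A bound for \<open>x k * (x k - x (k - 1))\<close> on the right half axis.
\<close>
definition cell_const :: real where "cell_const = \<Theta> / \<Lambda> * (1 + peak_max)"

text \<open>
  What \<open>abs_diff_le_of_flux_diff\<close> gives for a flux difference \<open>\<Lambda> \<delta> |x k|\<close> if \<open>(x k)\<^sup>2\<close> is at most \<open>(\<delta> / peak_min)\<^sup>2 + 2 K cell_const\<close>.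
\<close>
definition jump_bound :: "nat \<Rightarrow> real" where
  "jump_bound K = (\<Lambda> * sqrt ((delta K * (delta K / peak_min))\<^sup>2 + 2 * cell_const * delta K) / \<Theta>) powr (1 / (\<alpha> + 1/2))"

text \<open>
  A bound for \<open>\<Lambda> s\<^sup>2 / 2\<close> on the cell that contains the origin; it separates the two levels that enclose an equilibrium.
\<close>
definition level_gap :: "nat \<Rightarrow> real" where
  "level_gap K = \<Lambda> / 2 * (delta K / peak_min)\<^sup>2"

lemma peak_min_pos: "0 < peak_min" using Theta_pos Lambda_pos by (simp add: peak_min_def)
lemma peak_max_pos: "0 < peak_max" using Theta_pos Lambda_pos by (simp add: peak_max_def add_pos_pos)
lemma cell_const_pos: "0 < cell_const" using Theta_pos Lambda_pos peak_max_pos by (simp add: cell_const_def)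

lemma jump_bound_nonneg: "0 \<le> jump_bound K" by (simp add: jump_bound_def)

end

text \<open>
  The equilibrium equations, for abstract densities and with a marked cell \<open>j\<close> that contains the origin. Both inequalities for
  \<open>j\<close> are weak in order to make the situation symmetric under reflection.
\<close>
locale steady = entropy_params +
  fixes K :: nat and x z :: "nat \<Rightarrow> real" and j :: nat
  assumes K_ge: "2 \<le> K"
    and z_pos: "\<And>k. k \<in> {1..K} \<Longrightarrow> 0 < z k"
    and z_ends: "z 0 = 0" "z (Suc K) = 0"
    and gap: "\<And>k. k \<in> {1..K} \<Longrightarrow> x k - x (k - 1) = delta K / z k"
    and balance: "\<And>k. k \<le> K \<Longrightarrow> P (z k) - P (z (Suc k)) = \<Lambda> * delta K * x k"
    and j_range: "j \<in> {1..K}"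
    and center: "x (j - 1) \<le> 0" "0 \<le> x j"
begin

lemma delta_pos: "0 < delta K" and delta_K: "delta K * real K = 1"
  using K_ge by (auto simp: delta_def)

text \<open>
  Reflection at the origin carries every estimate for the right half axis over to the left one.
\<close>
lemma mirror: "steady \<alpha> lam K (\<lambda>k. - x (K - k)) (\<lambda>k. z (Suc K - k)) (Suc K - j)"
proof unfold_locales
  fix k
  show "0 < z (Suc K - k)" if "k \<in> {1..K}" using that by (intro z_pos) auto
  show "- x (K - k) - - x (K - (k - 1)) = delta K / z (Suc K - k)" if k: "k \<in> {1..K}"
  proof -
    have "K - (k - 1) = Suc K - k" "Suc K - k - 1 = K - k" using k by auto
    moreover have "Suc K - k \<in> {1..K}" using k by auto
    ultimately show ?thesis using gap[of "Suc K - k"] by simp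
  qed
  show "P (z (Suc K - k)) - P (z (Suc K - Suc k)) = \<Lambda> * delta K * - x (K - k)" if "k \<le> K"
    using balance[of "K - k"] that by (simp add: Suc_diff_le)
next
  have e: "K - (Suc K - j - 1) = j" "K - (Suc K - j) = j - 1" using j_range by auto
  show "- x (K - (Suc K - j - 1)) \<le> 0" "0 \<le> - x (K - (Suc K - j))" unfolding e using center by auto
qed (use K_ge z_ends j_range in auto)

lemma x_step: "k \<in> {1..K} \<Longrightarrow> x (k - 1) < x k"
  using gap[of k] z_pos[of k] delta_pos by (smt (verit) divide_pos_pos)

lemma x_mono: "i \<le> k \<Longrightarrow> k \<le> K \<Longrightarrow> x i \<le> x k"
proof (induction k rule: dec_induct)
  case (step k)
  then show ?case using x_step[of "Suc k"] by simp
qed simp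

lemma x_nonneg: "j \<le> k \<Longrightarrow> k \<le> K \<Longrightarrow> 0 \<le> x k"
  using x_mono[of j k] center by simp

lemma z_nonneg: "k \<le> Suc K \<Longrightarrow> 0 \<le> z k"
  using z_pos[of k] z_ends by (cases "k = 0 \<or> k = Suc K") auto

lemma z_step: "j \<le> k \<Longrightarrow> k \<le> K \<Longrightarrow> z (Suc k) \<le> z k"
proof -
  assume k: "j \<le> k" "k \<le> K"
  have "0 \<le> P (z k) - P (z (Suc k))"
    unfolding balance[OF k(2)] using x_nonneg[OF k] Lambda_pos delta_pos by simp
  then show ?thesis using flux_le_iff[of "z (Suc k)" "z k"] z_nonneg k by simp
qed

lemma z_antimono: "i \<le> k \<Longrightarrow> j \<le> i \<Longrightarrow> k \<le> Suc K \<Longrightarrow> z k \<le> z i"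
proof (induction k rule: dec_induct)
  case (step k)
  then show ?case using z_step[of k] by simp
qed simp

text \<open>
  The discrete form of the conservation of \<open>h(u) + \<Lambda> x\<^sup>2 / 2\<close>. With \<open>enthalpy_diff_le\<close>, the enthalpy falls by at most
  \<open>\<Lambda> x k (x (k + 1) - x k)\<close>, and the tangent to the parabola at \<open>x k\<close> lies below it.
\<close>
lemma right_energy_step:
  assumes k: "k \<in> {1..<K}"
  shows "h (z k) + \<Lambda> / 2 * (x k)\<^sup>2 \<le> h (z (Suc k)) + \<Lambda> / 2 * (x (Suc k))\<^sup>2"
proof -
  have pos: "0 < z k" "0 < z (Suc k)" using z_pos k by auto
  have "h (z k) - h (z (Suc k)) \<le> (P (z k) - P (z (Suc k))) / z (Suc k)"
    by (rule enthalpy_diff_le[OF pos])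
  also have "\<dots> = \<Lambda> * (x k * (delta K / z (Suc k)))" using balance[of k] k by simp
  also have "\<dots> = \<Lambda> * (x k * (x (Suc k) - x k))" using gap[of "Suc k"] k by simp
  also have "\<dots> = \<Lambda> / 2 * ((x (Suc k))\<^sup>2 - (x k)\<^sup>2) - \<Lambda> / 2 * (x (Suc k) - x k)\<^sup>2"
    by (simp add: power2_eq_square algebra_simps)
  also have "\<dots> \<le> \<Lambda> / 2 * ((x (Suc k))\<^sup>2 - (x k)\<^sup>2)" using Lambda_pos by simp
  finally show ?thesis by (simp add: algebra_simps)
qed

lemma right_energy_mono:
  "i \<le> k \<Longrightarrow> 1 \<le> i \<Longrightarrow> k \<le> K \<Longrightarrow>
    h (z i) + \<Lambda> / 2 * (x i)\<^sup>2 \<le> h (z k) + \<Lambda> / 2 * (x k)\<^sup>2"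
proof (induction k rule: dec_induct)
  case (step k)
  then show ?case using right_energy_step[of k] by simp
qed simp

text \<open>
  The reflection of \<open>right_energy_mono\<close>: it uses left instead of right endpoints, and the order reverses.
\<close>
lemma left_energy_antimono:
  assumes "1 \<le> i" "i \<le> k" "k \<le> K"
  shows "h (z k) + \<Lambda> / 2 * (x (k - 1))\<^sup>2 \<le> h (z i) + \<Lambda> / 2 * (x (i - 1))\<^sup>2"
proof -
  interpret M: steady \<alpha> lam K "\<lambda>k. - x (K - k)" "\<lambda>k. z (Suc K - k)" "Suc K - j" by (rule mirror)
  have "K - (Suc K - k) = k - 1" "K - (Suc K - i) = i - 1" using assms by auto
  then show ?thesis using M.right_energy_mono[of "Suc K - k" "Suc K - i"] assms by simp
qed

lemma flux_sum: "i \<le> k \<Longrightarrow> k \<le> K \<Longrightarrow> P (z i) - P (z (Suc k)) = \<Lambda> * delta K * (\<Sum>m = i..k. x m)"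
proof (induction k rule: dec_induct)
  case base
  then show ?case using balance[of i] by simp
next
  case (step k)
  then show ?case using balance[of "Suc k"] by (simp add: algebra_simps)
qed

lemma x_ge: "j \<le> k \<Longrightarrow> k \<le> K \<Longrightarrow> real (k - j) * (delta K / z j) \<le> x k"
proof (induction k rule: dec_induct)
  case base
  then show ?case using center by simp
next
  case (step k)
  have "delta K / z j \<le> delta K / z (Suc k)"
    using z_antimono[of j "Suc k"] step z_pos[of "Suc k"] z_pos[OF j_range] delta_pos
    by (intro divide_left_mono) auto
  also have "\<dots> = x (Suc k) - x k" using gap[of "Suc k"] step by simp
  finally have "delta K / z j \<le> x (Suc k) - x k" .
  moreover have "real (Suc k - j) = real (k - j) + 1" using step by (simp add: Suc_diff_le)
  ultimately show ?case using step by (simp only: distrib_right) simp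
qed

text \<open>
  As \<open>z\<close> is at most \<open>z j\<close>, the points to the right of the origin are spread out at least as widely as a lattice of spacing \<open>\<delta> / z j\<close>, and \<open>P (z j)\<close> is
  \<open>\<Lambda> \<delta>\<close> times the sum of their positions.
\<close>
lemma half_flux_lower:
  "\<Lambda> * (delta K)\<^sup>2 * ((real (K - j))\<^sup>2 / 2) \<le> P (z j) * z j"
proof -
  have zj: "0 < z j" by (rule z_pos[OF j_range])
  have tri: "(real n)\<^sup>2 / 2 \<le> (\<Sum>m = j..j + n. real (m - j))" for n
    by (induction n) (auto simp: power2_eq_square algebra_simps)
  have "(real (K - j))\<^sup>2 / 2 * (delta K / z j) \<le> (\<Sum>m = j..K. real (m - j)) * (delta K / z j)"
    using tri[of "K - j"] j_range zj delta_pos by (intro mult_right_mono) auto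
  also have "\<dots> \<le> (\<Sum>m = j..K. x m)"
    unfolding sum_distrib_right by (intro sum_mono x_ge) auto
  finally have "\<Lambda> * delta K * ((real (K - j))\<^sup>2 / 2 * (delta K / z j)) \<le> \<Lambda> * delta K * (\<Sum>m = j..K. x m)"
    using Lambda_pos delta_pos by (intro mult_left_mono) auto
  also have "\<dots> = P (z j)" using flux_sum[of j K] j_range z_ends by simp
  finally have "\<Lambda> * delta K * ((real (K - j))\<^sup>2 / 2 * (delta K / z j)) * z j \<le> P (z j) * z j"
    using zj by (intro mult_right_mono) auto
  then show ?thesis using zj by (simp add: power2_eq_square algebra_simps)
qed

text \<open>
  One of the two sides of the origin carries about half of the cells, so the estimate \<open>half_flux_lower\<close> and its reflection add up to a
  lower bound for \<open>P (z j) * z j\<close>.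
\<close>
lemma peak_min_le: "peak_min \<le> z j"
proof -
  interpret M: steady \<alpha> lam K "\<lambda>k. - x (K - k)" "\<lambda>k. z (Suc K - k)" "Suc K - j" by (rule mirror)
  have zj: "0 < z j" by (rule z_pos[OF j_range])
  define a where "a = real (K - j)"
  define b where "b = real (j - 1)"
  have ab: "a + b = real K - 1" using j_range by (auto simp: a_def b_def of_nat_diff)
  have e: "K - (Suc K - j) = j - 1" "Suc K - (Suc K - j) = j" using j_range by auto
  have "\<Lambda> * (delta K)\<^sup>2 * (a\<^sup>2 / 2) + \<Lambda> * (delta K)\<^sup>2 * (b\<^sup>2 / 2) \<le> 2 * (P (z j) * z j)"
    using half_flux_lower M.half_flux_lower unfolding e a_def b_def by simp
  moreover have "(real K)\<^sup>2 / 16 \<le> a\<^sup>2 / 2 + b\<^sup>2 / 2"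
  proof -
    have "(a + b)\<^sup>2 \<le> 2 * a\<^sup>2 + 2 * b\<^sup>2" using sum_squares_bound[of a b] by (simp add: power2_sum)
    moreover have "(real K / 2)\<^sup>2 \<le> (a + b)\<^sup>2" unfolding ab using K_ge by (intro power_mono) auto
    ultimately show ?thesis by (simp add: power_divide)
  qed
  then have "\<Lambda> * (delta K)\<^sup>2 * ((real K)\<^sup>2 / 16) \<le> \<Lambda> * (delta K)\<^sup>2 * (a\<^sup>2 / 2 + b\<^sup>2 / 2)"
    using Lambda_pos by (intro mult_left_mono) auto
  moreover have "\<Lambda> * (delta K)\<^sup>2 * ((real K)\<^sup>2 / 16) = \<Lambda> / 16"
    using delta_K by (simp add: power_mult_distrib[symmetric] mult.assoc)
  ultimately have main: "\<Lambda> / 32 \<le> P (z j) * z j" unfolding distrib_left by linarith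
  show ?thesis
  proof (cases "z j \<le> 1")
    case True
    have "z j powr (\<alpha> + 1/2) \<le> z j powr 0" using True zj alpha_ge by (intro powr_mono') auto
    then have "P (z j) \<le> \<Theta> * 1" unfolding flux_def using Theta_pos zj by (intro mult_left_mono) auto
    then have "P (z j) * z j \<le> \<Theta> * z j" using zj by simp
    then have "\<Lambda> / (32 * \<Theta>) \<le> z j" using main Theta_pos by (simp add: divide_simps) (simp add: algebra_simps)
    then show ?thesis by (simp add: peak_min_def)
  qed (simp add: peak_min_def)
qed

text \<open>
  The cells between the origin and \<open>x k\<close> have density at least \<open>z k\<close> and total mass at most 1.
\<close>
lemma x_le_inverse_z: "j \<le> k \<Longrightarrow> k \<le> K \<Longrightarrow> x k \<le> 1 / z k"
proof -
  assume k: "j \<le> k" "k \<le> K"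
  have zk: "0 < z k" using z_pos k j_range by simp
  have step: "x m - x (m - 1) \<le> delta K / z k" if m: "m \<in> {j..k}" for m
  proof -
    have m': "m \<in> {1..K}" using m k j_range by simp
    show ?thesis unfolding gap[OF m'] using z_antimono[of m k] m k zk delta_pos z_pos[OF m']
      by (intro divide_left_mono) auto
  qed
  have "x k - x (j - 1) = (\<Sum>m = j..k. x m - x (m - 1))" 
    using k(1) by (induction k rule: dec_induct) auto
  also have "\<dots> \<le> (\<Sum>m = j..k. delta K / z k)" by (rule sum_mono[OF step])
  also have "\<dots> = real (Suc k - j) * (delta K / z k)" by simp
  also have "\<dots> \<le> real K * (delta K / z k)"
    using k j_range zk delta_pos by (intro mult_right_mono) auto
  also have "\<dots> = 1 / z k" using delta_K by (simp add: mult.commute)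
  finally show ?thesis using center by simp
qed

text \<open>
  Where the density has dropped to half of its maximum \<open>M\<close>, the position is at most \<open>2 / M\<close> because at most unit mass, of density
  at least \<open>M / 2\<close>, lies in between. So the flux has dropped by at most \<open>2 \<Lambda> / M\<close>, while \<open>P M - P (M / 2)\<close> is at least half of \<open>P M\<close>.
\<close>
lemma le_peak_max: "z j \<le> peak_max"
proof (cases "z j \<le> 1")
  case True
  then show ?thesis using Theta_pos Lambda_pos by (simp add: peak_max_def add_increasing2)
next
  case False
  define M where "M = z j"
  have M: "1 < M" using False by (simp add: M_def)
  \<comment> \<open>The last cell to the right of the origin with density at least \<open>M / 2\<close>; it exists because \<open>z (Suc K) = 0\<close>.\<close>
  define k where "k = (LEAST k. j \<le> k \<and> z (Suc k) < M / 2)"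
  have ex: "j \<le> K \<and> z (Suc K) < M / 2" using z_ends M j_range by simp
  have k: "j \<le> k \<and> z (Suc k) < M / 2" unfolding k_def by (rule LeastI[of _ K]) (rule ex)
  have kK: "k \<le> K" unfolding k_def by (rule Least_le) (rule ex)
  have zk: "M / 2 \<le> z k"
  proof (cases "k = j")
    case True
    then show ?thesis using M by (simp add: M_def)
  next
    case False
    then have "k - 1 < (LEAST k. j \<le> k \<and> z (Suc k) < M / 2)"
      using k unfolding k_def[symmetric] by simp
    then have "\<not> (j \<le> k - 1 \<and> z (Suc (k - 1)) < M / 2)" by (rule not_less_Least)
    then show ?thesis using False k by (cases k) auto
  qed
  have xk: "x k \<le> 2 / M"
  proof -
    have "x k \<le> 1 / z k" using x_le_inverse_z k kK by simp
    also have "\<dots> \<le> 1 / (M / 2)" using zk M by (intro divide_left_mono) auto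
    finally show ?thesis by simp
  qed
  have "P M - P (M / 2) \<le> P (z j) - P (z (Suc k))"
    using flux_mono[of "z (Suc k)" "M / 2"] k z_nonneg[of "Suc k"] kK by (simp add: M_def)
  also have "\<dots> = \<Lambda> * delta K * (\<Sum>m = j..k. x m)" using flux_sum[of j k] k kK by simp
  also have "\<dots> \<le> \<Lambda> * delta K * (\<Sum>m = j..k. 2 / M)"
    using Lambda_pos delta_pos xk x_mono kK by (intro mult_left_mono sum_mono) (auto intro: order_trans)
  also have "\<dots> = \<Lambda> * delta K * (real (Suc k - j) * (2 / M))" by simp
  also have "\<dots> \<le> \<Lambda> * delta K * (real K * (2 / M))"
    using Lambda_pos delta_pos kK j_range M by (intro mult_left_mono mult_right_mono) auto
  also have "\<dots> = (delta K * real K) * (\<Lambda> * (2 / M))" by (simp only: mult_ac)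
  also have "\<dots> = 2 * \<Lambda> / M" unfolding delta_K by simp
  finally have 1: "P M - P (M / 2) \<le> 2 * \<Lambda> / M" .
  have "P (M / 2) \<le> P M / 2"
  proof -
    have "(1/2 :: real) powr (\<alpha> + 1/2) \<le> (1/2) powr 1" using alpha_ge by (intro powr_mono') auto
    then have "(M * (1/2)) powr (\<alpha> + 1/2) \<le> M powr (\<alpha> + 1/2) * (1/2)"
      unfolding powr_mult by (intro mult_left_mono) auto
    then have "\<Theta> * (M * (1/2)) powr (\<alpha> + 1/2) \<le> \<Theta> * (M powr (\<alpha> + 1/2) * (1/2))"
      using Theta_pos by (intro mult_left_mono) auto
    then show ?thesis by (simp add: flux_def)
  qed
  then have "P M \<le> 4 * \<Lambda> / M" using 1 by simp
  moreover have "\<Theta> * 1 \<le> P M"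
    unfolding flux_def using Theta_pos M alpha_ge by (intro mult_left_mono) (auto intro: ge_one_powr_ge_zero)
  ultimately have "\<Theta> \<le> 4 * \<Lambda> / M" by simp
  then have "M \<le> 4 * \<Lambda> / \<Theta>" using M Theta_pos by (simp add: divide_simps mult.commute)
  then show ?thesis by (simp add: peak_max_def M_def)
qed

text \<open>
  The outermost cells, whose density tends to 0, are much wider than \<open>\<delta>\<close>. But \<open>P (z k)\<close> supports the weight of all points farther out, in
  particular of \<open>x k\<close>, and so \<open>z k\<close> cannot be too small compared with \<open>x k\<close>.
\<close>
lemma x_times_gap: 
  assumes k: "j \<le> k" "k \<le> K"
  shows "x k * (x k - x (k - 1)) \<le> cell_const"
proof -
  have zk: "0 < z k" using z_pos k j_range by simp
  have "\<Lambda> * delta K * x k \<le> P (z k)"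
    using balance[OF k(2)] flux_mono[of 0 "z (Suc k)"] z_nonneg[of "Suc k"] k by simp
  then have "x k * delta K / z k \<le> P (z k) / \<Lambda> / z k"
    using Lambda_pos zk by (intro divide_right_mono) (auto simp: pos_le_divide_eq algebra_simps)
  also have "\<dots> = \<Theta> / \<Lambda> * z k powr (\<alpha> - 1/2)"
    using zk powr_diff[of "z k" "\<alpha> + 1/2" 1] by (simp add: flux_def)
  also have "\<dots> \<le> \<Theta> / \<Lambda> * (1 + peak_max)"
  proof (intro mult_left_mono)
    have "z k \<le> peak_max" using z_antimono[of j k] le_peak_max k by simp
    show "z k powr (\<alpha> - 1/2) \<le> 1 + peak_max"
    proof (cases "z k \<le> 1")
      case True
      then have "z k powr (\<alpha> - 1/2) \<le> 1 powr (\<alpha> - 1/2)" using alpha_ge zk by (intro powr_mono2) auto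
      then show ?thesis using peak_max_pos by simp
    next
      case False
      then have "z k powr (\<alpha> - 1/2) \<le> z k powr 1" using alpha_le by (intro powr_mono) auto
      then show ?thesis using \<open>z k \<le> peak_max\<close> zk by simp
    qed
  qed (use Theta_pos Lambda_pos in auto)
  finally show ?thesis using gap[of k] k j_range by (simp add: cell_const_def)
qed

lemma x_square_step:
  assumes k: "j \<le> k" "k \<le> K"
  shows "(x k)\<^sup>2 \<le> (x (k - 1))\<^sup>2 + 2 * cell_const"
proof -
  have "2 * (x k * (x k - x (k - 1))) \<le> 2 * cell_const" using x_times_gap[OF k] by simp
  moreover have "0 \<le> (x k - x (k - 1))\<^sup>2" by simp
  ultimately show ?thesis by (simp add: power2_eq_square algebra_simps)
qed

lemma center_gap: "x j - x (j - 1) \<le> delta K / peak_min"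
  unfolding gap[OF j_range] using peak_min_le peak_min_pos delta_pos by (intro divide_left_mono) auto

lemma x_square_le:
  assumes k: "j \<le> k" "k \<le> K"
  shows "(x k)\<^sup>2 \<le> (delta K / peak_min)\<^sup>2 + 2 * cell_const * real K"
proof -
  have "(x k)\<^sup>2 \<le> (x j)\<^sup>2 + 2 * cell_const * real (k - j)" using k
  proof (induction k rule: dec_induct)
    case (step k)
    then show ?case using x_square_step[of "Suc k"] by (simp add: Suc_diff_le algebra_simps)
  qed simp
  also have "\<dots> \<le> (delta K / peak_min)\<^sup>2 + 2 * cell_const * real K"
    using center center_gap cell_const_pos k by (intro add_mono power_mono mult_left_mono) auto
  finally show ?thesis .
qed

lemma jump_right:
  assumes k: "j \<le> k" "k \<le> K"
  shows "\<bar>z k - z (Suc k)\<bar> \<le> jump_bound K"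
  unfolding jump_bound_def
proof (rule abs_diff_le_of_flux_diff)
  have "(delta K * x k)\<^sup>2 \<le> (delta K)\<^sup>2 * ((delta K / peak_min)\<^sup>2 + 2 * cell_const * real K)"
    unfolding power_mult_distrib by (intro mult_left_mono x_square_le k) auto
  also have "\<dots> = (delta K * (delta K / peak_min))\<^sup>2 + 2 * cell_const * delta K * (delta K * real K)"
    by (simp add: power2_eq_square algebra_simps)
  finally have "(delta K * x k)\<^sup>2 \<le> (delta K * (delta K / peak_min))\<^sup>2 + 2 * cell_const * delta K"
    unfolding delta_K by simp
  then have "delta K * x k \<le> sqrt ((delta K * (delta K / peak_min))\<^sup>2 + 2 * cell_const * delta K)"
    by (rule real_le_rsqrt)
  then have "\<Lambda> * (delta K * x k) \<le> \<Lambda> * sqrt ((delta K * (delta K / peak_min))\<^sup>2 + 2 * cell_const * delta K)"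
    using Lambda_pos by (intro mult_left_mono) auto
  moreover have "0 \<le> \<Lambda> * delta K * x k" using x_nonneg[OF k] Lambda_pos delta_pos by simp
  ultimately show "\<bar>P (z k) - P (z (Suc k))\<bar> \<le> \<Lambda> * sqrt ((delta K * (delta K / peak_min))\<^sup>2 + 2 * cell_const * delta K)"
    unfolding balance[OF k(2)] by (simp add: mult.assoc)
qed (use z_nonneg k in auto)

lemma jump: 
  assumes k: "k \<le> K"
  shows "\<bar>z k - z (Suc k)\<bar> \<le> jump_bound K"
proof (cases "j \<le> k")
  case False
  interpret M: steady \<alpha> lam K "\<lambda>k. - x (K - k)" "\<lambda>k. z (Suc K - k)" "Suc K - j" by (rule mirror)
  have "Suc K - (K - k) = Suc k" "Suc K - Suc (K - k) = k" using k by auto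
  then show ?thesis using M.jump_right[of "K - k"] False k by (simp add: abs_minus_commute)
qed (use jump_right k in simp)

text \<open>
  The level of the profile with the same maximum as the equilibrium.
\<close>
definition level :: real where "level = h (z j)"

lemma level_in: "level \<in> {h peak_min..h peak_max}"
proof -
  have f_mono: "f a \<le> f b" if "0 < a" "a \<le> b" for a b
    by (rule DERIV_nonneg_imp_nondecreasing[OF that(2)])
       (use f_deriv that Theta_pos in \<open>meson less_le_trans less_imp_le mult_nonneg_nonneg powr_ge_zero\<close>)
  have "h a \<le> h b" if "0 < a" "a \<le> b" for a b
    unfolding enthalpy_def using f_mono[OF that] alpha_ge by (intro mult_left_mono) auto
  then show ?thesis using peak_min_le le_peak_max peak_min_pos z_pos[OF j_range] by (simp add: level_def)
qed

lemma z_le_B: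
  assumes "k \<in> {1..K}" "h (z k) \<le> c - \<Lambda> / 2 * s\<^sup>2"
  shows "z k \<le> B c s"
  using hinv_mono[OF assms(2)] hinv_enthalpy[OF z_pos[OF assms(1)]] by (simp add: level_profile_def)

lemma B_le_z:
  assumes "k \<in> {1..K}" "c - \<Lambda> / 2 * s\<^sup>2 \<le> h (z k)"
  shows "B c s \<le> z k"
  using hinv_mono[OF assms(2)] hinv_enthalpy[OF z_pos[OF assms(1)]] by (simp add: level_profile_def)

lemma Lambda_square_mono: "0 \<le> r \<Longrightarrow> r \<le> s \<Longrightarrow> \<Lambda> / 2 * r\<^sup>2 \<le> \<Lambda> / 2 * s\<^sup>2"
  using Lambda_pos by (intro mult_left_mono power_mono) auto

lemma right_lower:
  assumes k: "j \<le> k" "k \<le> K"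
  shows "level \<le> h (z k) + \<Lambda> / 2 * (x k)\<^sup>2"
proof -
  have "0 \<le> \<Lambda> / 2 * (x j)\<^sup>2" using Lambda_pos by simp
  then show ?thesis using right_energy_mono[of j k] k j_range by (simp add: level_def)
qed

lemma right_upper:
  assumes k: "j \<le> k" "k \<le> K"
  shows "h (z k) + \<Lambda> / 2 * (x (k - 1))\<^sup>2 \<le> level + level_gap K"
proof -
  have "\<Lambda> / 2 * (- x (j - 1))\<^sup>2 \<le> level_gap K"
    unfolding level_gap_def by (rule Lambda_square_mono) (use center center_gap in auto)
  then show ?thesis using left_energy_antimono[of j k] k j_range by (simp add: level_def)
qed

text \<open>
  The energy of the inward neighbour bounds the profile from above at \<open>s\<close>, and that of the outward neighbour bounds it from below; the
  neighbours differ from \<open>z k\<close> by at most one jump. Beyond the last cell the outward neighbour has density 0. The third estimate compares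
  with the cell itself and allows for its width by raising the level; it supplies an integrable majorant.
\<close>
lemma right_cell:
  assumes k: "j \<le> k" "k \<le> K" and s: "x (k - 1) \<le> s" "s \<le> x k" "0 \<le> s"
  shows "B level s \<le> z k + jump_bound K"
    and "z k \<le> B (level + level_gap K) s + jump_bound K"
    and "z k \<le> B (level + level_gap K + \<Lambda> * cell_const) s"
proof -
  have k1: "k \<in> {1..K}" using k j_range by simp
  show "B level s \<le> z k + jump_bound K"
  proof (cases "k = j")
    case True
    have "B level s \<le> z j" 
      by (rule B_le_z[OF j_range]) (use Lambda_pos in \<open>simp add: level_def\<close>)
    then show ?thesis using True jump_bound_nonneg[of K] by simp
  next
    case False
    then have k': "j \<le> k - 1" "k - 1 \<le> K" "k - 1 \<in> {1..K}" "Suc (k - 1) = k" using k j_range by auto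
    have "\<Lambda> / 2 * (x (k - 1))\<^sup>2 \<le> \<Lambda> / 2 * s\<^sup>2"
      by (rule Lambda_square_mono) (use x_nonneg k' s in auto)
    then have "B level s \<le> z (k - 1)"
      using right_lower[OF k'(1,2)] by (intro B_le_z k') simp
    then show ?thesis using jump[OF k'(2)] k'(4) by simp
  qed
  show "z k \<le> B (level + level_gap K) s + jump_bound K"
  proof (cases "k = K")
    case True
    then show ?thesis using jump[of K] z_ends by (simp add: add_increasing)
  next
    case False
    then have k': "j \<le> Suc k" "Suc k \<le> K" "Suc k \<in> {1..K}" using k by auto
    have "\<Lambda> / 2 * s\<^sup>2 \<le> \<Lambda> / 2 * (x k)\<^sup>2"
      by (rule Lambda_square_mono) (use s in auto)
    then have "z (Suc k) \<le> B (level + level_gap K) s"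
      using right_upper[OF k'(1,2)] by (intro z_le_B k') simp
    then show ?thesis using jump[OF k(2)] by simp
  qed
  show "z k \<le> B (level + level_gap K + \<Lambda> * cell_const) s"
  proof (rule z_le_B[OF k1])
    have "\<Lambda> / 2 * s\<^sup>2 \<le> \<Lambda> / 2 * (x k)\<^sup>2"
      by (rule Lambda_square_mono) (use s in auto)
    also have "\<dots> \<le> \<Lambda> / 2 * ((x (k - 1))\<^sup>2 + 2 * cell_const)"
      using x_square_step[OF k] Lambda_pos by (intro mult_left_mono) auto
    finally show "h (z k) \<le> level + level_gap K + \<Lambda> * cell_const - \<Lambda> / 2 * s\<^sup>2"
      using right_upper[OF k] by (simp add: distrib_left)
  qed
qed

lemma right_outside:
  assumes s: "x K \<le> s"
  shows "B level s \<le> jump_bound K"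
proof -
  have "\<Lambda> / 2 * (x K)\<^sup>2 \<le> \<Lambda> / 2 * s\<^sup>2"
    by (rule Lambda_square_mono) (use s x_nonneg j_range in auto)
  then have "B level s \<le> z K"
    using right_lower[of K] j_range K_ge by (intro B_le_z) auto
  then show ?thesis using jump[of K] z_ends by simp
qed

text \<open>
  On the right half axis this is \<open>right_cell\<close>, on the left one its reflection. The marked cell is split at the origin. Closed cells
  make the statement invariant under reflection.
\<close>
lemma cell:
  assumes k: "k \<in> {1..K}" and s: "x (k - 1) \<le> s" "s \<le> x k"
  shows "B level s \<le> z k + jump_bound K"
    and "z k \<le> B (level + level_gap K) s + jump_bound K"
    and "z k \<le> B (level + level_gap K + \<Lambda> * cell_const) s"
proof -
  have "B level s \<le> z k + jump_bound K \<and> z k \<le> B (level + level_gap K) s + jump_bound K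
    \<and> z k \<le> B (level + level_gap K + \<Lambda> * cell_const) s"
  proof (cases "j < k \<or> k = j \<and> 0 \<le> s")
    case True
    have "0 \<le> s"
    proof (cases "j < k")
      case True
      then have "j \<le> k - 1" "k - 1 \<le> K" using k by auto
      then show ?thesis using x_nonneg[of "k - 1"] s by simp
    qed (use True in simp)
    then show ?thesis using right_cell[of k s] True k s by auto
  next
    case False
    interpret M: steady \<alpha> lam K "\<lambda>k. - x (K - k)" "\<lambda>k. z (Suc K - k)" "Suc K - j" by (rule mirror)
    have "Suc K - (Suc K - j) = j" using j_range by simp
    then have lev: "M.level = level" by (simp add: M.level_def level_def)
    have refl: "B c (- s) = B c s" for c by (simp add: level_profile_def)
    have e: "K - (Suc K - k) = k - 1" "Suc K - k - 1 = K - k" "K - (K - k) = k" "Suc K - (Suc K - k) = k"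
      using k by auto
    have "s \<le> 0"
    proof (cases "k = j")
      case True
      then show ?thesis using \<open>\<not> (j < k \<or> k = j \<and> 0 \<le> s)\<close> by simp
    next
      case F: False
      then have "k \<le> j - 1" using False by simp
      then have "x k \<le> x (j - 1)" using j_range by (intro x_mono) auto
      then show ?thesis using center s by simp
    qed
    then show ?thesis
      using M.right_cell[of "Suc K - k" "- s", unfolded lev refl e] False k s by auto
  qed
  then show "B level s \<le> z k + jump_bound K"
    "z k \<le> B (level + level_gap K) s + jump_bound K"
    "z k \<le> B (level + level_gap K + \<Lambda> * cell_const) s" by auto
qed

lemma outside:
  assumes "s \<notin> {x 0<..<x K}"
  shows "B level s \<le> jump_bound K"
proof (cases "x K \<le> s")
  case False
  interpret M: steady \<alpha> lam K "\<lambda>k. - x (K - k)" "\<lambda>k. z (Suc K - k)" "Suc K - j" by (rule mirror)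
  have "Suc K - (Suc K - j) = j" using j_range by simp
  then have lev: "M.level = level" by (simp add: M.level_def level_def)
  have refl: "B c (- s) = B c s" for c by (simp add: level_profile_def)
  show ?thesis using M.right_outside[of "- s", unfolded lev refl] False assms by simp
qed (rule right_outside)

end

section \<open>Passage to the limit\<close>

lemma config_cell:
  fixes x :: "nat \<Rightarrow> real"
  assumes "x 0 < s" "s \<le> x K"
  obtains k where "k \<in> {1..K}" "x (k - 1) < s" "s \<le> x k"
proof -
  define k where "k = (LEAST k. s \<le> x k)"
  have k: "s \<le> x k" unfolding k_def by (rule LeastI[of _ K]) (rule assms)
  have kK: "k \<le> K" unfolding k_def by (rule Least_le) (rule assms)
  have k0: "k \<noteq> 0" using k assms by (intro notI) simp
  then have "k - 1 < (LEAST k. s \<le> x k)" unfolding k_def[symmetric] by simp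
  then have "\<not> s \<le> x (k - 1)" by (rule not_less_Least)
  then show thesis using that[of k] k kK k0 by simp
qed

lemma configs_mono:
  assumes "x \<in> configs K" "i \<le> k" "k \<le> K"
  shows "x i \<le> x k"
  using assms by (cases "i = k") (auto simp: configs_def strict_mono_on_def less_imp_le)

lemma u_delta_cell:
  assumes x: "x \<in> configs K" and k: "k \<in> {1..K}" and s: "x (k - 1) < s" "s \<le> x k"
  shows "u_delta K x s = zval K x k"
proof -
  have "delta K / (x i - x (i - 1)) * indicator {x (i - 1)<..x i} s
      = (if i = k then zval K x k else 0)" if i: "i \<in> {1..K}" for i
  proof (cases "i = k")
    case False
    have "s \<notin> {x (i - 1)<..x i}"
    proof (cases "i < k")
      case True
      then have "i \<le> k - 1" "k - 1 \<le> K" using k by auto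
      then show ?thesis using configs_mono[OF x, of i "k - 1"] s by auto
    next
      case F: False
      then have "k \<le> i - 1" "i - 1 \<le> K" using False i by auto
      then show ?thesis using configs_mono[OF x, of k "i - 1"] s by auto
    qed
    then show ?thesis using False by simp
  qed (use s i in \<open>simp add: zval_def\<close>)
  then have "u_delta K x s = (\<Sum>i = 1..K. if i = k then zval K x k else 0)"
    unfolding u_delta_def by (intro sum.cong) auto
  then show ?thesis using k by simp
qed

lemma u_delta_outside:
  assumes x: "x \<in> configs K" and s: "s \<le> x 0 \<or> x K < s"
  shows "u_delta K x s = 0"
  unfolding u_delta_def
proof (intro sum.neutral ballI)
  fix k assume "k \<in> {1..K}"
  then have "k - 1 \<le> K" "k \<le> K" by auto
  then have "s \<notin> {x (k - 1)<..x k}"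
    using configs_mono[OF x, of 0 "k - 1"] configs_mono[OF x, of k K] s by auto
  then show "delta K / (x k - x (k - 1)) * indicator {x (k - 1)<..x k} s = 0" by simp
qed

lemma emeasure_Ioc_finite: "emeasure lborel {a<..b::real} < \<infinity>"
  by (cases "a \<le> b") auto

lemma has_bochner_integral_u_delta:
  assumes x: "x \<in> configs K" and K: "0 < K"
  shows "has_bochner_integral lborel (u_delta K x) 1"
proof -
  have "has_bochner_integral lborel (\<lambda>s. delta K / (x k - x (k - 1)) * indicator {x (k - 1)<..x k} s)
      (delta K / (x k - x (k - 1)) * (x k - x (k - 1)))" if k: "k \<in> {1..K}" for k
  proof (rule has_bochner_integral_mult_right)
    have "has_bochner_integral lborel (indicator {x (k - 1)<..x k} :: real \<Rightarrow> real) (measure lborel {x (k - 1)<..x k})"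
      using emeasure_bounded_finite[of "{x (k - 1)<..x k}"] bounded_subset[OF bounded_closed_interval, of "{x (k - 1)<..x k}"]
      by (intro has_bochner_integral_real_indicator) auto
    then show "has_bochner_integral lborel (indicator {x (k - 1)<..x k} :: real \<Rightarrow> real) (x k - x (k - 1))"
      using configs_step[OF x k] by simp
  qed
  then have "has_bochner_integral lborel (u_delta K x) (\<Sum>k = 1..K. delta K / (x k - x (k - 1)) * (x k - x (k - 1)))"
    unfolding u_delta_def[abs_def] by (rule has_bochner_integral_sum)
  also have "(\<Sum>k = 1..K. delta K / (x k - x (k - 1)) * (x k - x (k - 1))) = (\<Sum>k = 1..K. delta K)"
    using configs_step[OF x] by (intro sum.cong) force+
  also have "\<dots> = 1" using K by (simp add: delta_def)
  finally show ?thesis .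
qed

lemma borel_u_delta [measurable]: "u_delta K x \<in> borel_measurable borel"
  unfolding u_delta_def[abs_def] by measurable

lemma xi_strict_mono: "0 < K \<Longrightarrow> strict_mono_on {0..n} (xi K)"
  by (auto simp: strict_mono_on_def xi_def delta_def divide_strict_right_mono)

lemma hat_node_even: "0 < K \<Longrightarrow> m \<le> K \<Longrightarrow> hat_node K x (2 * m) = x m"
  unfolding hat_node_def X_delta_def by (simp add: pw_affine_node xi_strict_mono)

lemma hat_node_odd:
  assumes "0 < K" "m < K"
  shows "hat_node K x (Suc (2 * m)) = (x m + x (Suc m)) / 2"
proof -
  have mono: "strict_mono_on {0..K} (xi K)" using assms by (intro xi_strict_mono)
  have d: "xi K (Suc m) = xi K m + delta K" "0 < delta K"
    using assms by (auto simp: xi_def delta_def add_divide_distrib)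
  have "hat_node K x (Suc (2 * m)) = pw_affine K (xi K) x (xi_mid K (Suc m))"
    by (simp add: hat_node_def X_delta_def)
  also have "\<dots> = x m + (x (Suc m) - x m) / (xi K (Suc m) - xi K m) * (xi_mid K (Suc m) - xi K m)"
    by (rule pw_affine_on_piece[OF mono \<open>m < K\<close>]) (use d in \<open>simp add: xi_mid_def\<close>)
  also have "xi_mid K (Suc m) - xi K m = delta K / 2" unfolding xi_mid_def diff_Suc_1 d(1) by (simp add: field_simps)
  also have "xi K (Suc m) - xi K m = delta K" using d by simp
  also have "x m + (x (Suc m) - x m) / delta K * (delta K / 2) = (x m + x (Suc m)) / 2" using d(2) by (simp add: field_simps)
  finally show ?thesis .
qed

lemma hat_node_strict_mono:
  assumes x: "x \<in> configs K" and K: "0 < K"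
  shows "strict_mono_on {0..2 * K} (hat_node K x)"
proof (rule strict_mono_on_steps)
  fix i assume i: "i < 2 * K"
  show "hat_node K x i < hat_node K x (Suc i)"
  proof (cases "even i")
    case True
    then obtain m where m: "i = 2 * m" by blast
    have "x m < x (Suc m)" using configs_step[OF x, of "Suc m"] i m by simp
    then show ?thesis using i m K by (simp add: hat_node_even hat_node_odd)
  next
    case False
    then obtain m where m: "i = Suc (2 * m)" by (metis oddE Suc_eq_plus1)
    have "x m < x (Suc m)" using configs_step[OF x, of "Suc m"] i m by simp
    then show ?thesis using i m K hat_node_even[of K "Suc m" x] hat_node_odd[of K m x] by simp
  qed
qed

lemma affine_between:
  fixes a b t0 t1 s z J :: real
  assumes "t0 < t1" "t0 \<le> s" "s \<le> t1" "\<bar>a - z\<bar> \<le> J" "\<bar>b - z\<bar> \<le> J"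
  shows "\<bar>a + (b - a) / (t1 - t0) * (s - t0) - z\<bar> \<le> J"
proof -
  define w where "w = (s - t0) / (t1 - t0)"
  have w: "0 \<le> w" "w \<le> 1" using assms by (auto simp: w_def)
  have "a + (b - a) / (t1 - t0) * (s - t0) - z = (1 - w) * (a - z) + w * (b - z)"
  proof -
    have "(b - a) / (t1 - t0) * (s - t0) = w * (b - a)" by (simp add: w_def)
    then show ?thesis by (simp add: algebra_simps)
  qed
  also have "\<bar>\<dots>\<bar> \<le> (1 - w) * \<bar>a - z\<bar> + w * \<bar>b - z\<bar>"
    using w abs_triangle_ineq[of "(1 - w) * (a - z)" "w * (b - z)"] by (simp add: abs_mult)
  also have "\<dots> \<le> (1 - w) * J + w * J" using w assms by (intro add_mono mult_left_mono) auto
  finally show ?thesis by (simp add: algebra_simps)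
qed

text \<open>
  On the cell the interpolation runs through \<open>(z (k - 1) + z k) / 2\<close>, \<open>z k\<close> and \<open>(z k + z (k + 1)) / 2\<close>.
\<close>
lemma u_hat_cell:
  assumes x: "x \<in> configs K" and k: "k \<in> {1..K}" and s: "x (k - 1) \<le> s" "s \<le> x k"
    and jump: "\<And>k. k \<le> K \<Longrightarrow> \<bar>zval K x k - zval K x (Suc k)\<bar> \<le> J"
  shows "\<bar>u_hat K x s - zval K x k\<bar> \<le> J"
proof -
  obtain m where m: "k = Suc m" using k by (cases k) auto
  have K: "0 < K" "m < K" "Suc m \<le> K" using k m by auto
  note mono = hat_node_strict_mono[OF x K(1)]
  have J: "0 \<le> J" using jump[of 0] by linarith
  have t: "hat_node K x (2 * m) = x m" "hat_node K x (Suc (2 * m)) = (x m + x (Suc m)) / 2"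
    "hat_node K x (Suc (Suc (2 * m))) = x (Suc m)"
    using hat_node_even[of K m x] hat_node_odd[of K m x] hat_node_even[of K "Suc m" x] K by auto
  have v: "hat_value K x (2 * m) = (zval K x (Suc m) + zval K x m) / 2"
    "hat_value K x (Suc (2 * m)) = zval K x (Suc m)"
    "hat_value K x (Suc (Suc (2 * m))) = (zval K x (Suc (Suc m)) + zval K x (Suc m)) / 2"
    by (auto simp: hat_value_def)
  have xm: "x m < x (Suc m)" using configs_step[OF x, of "Suc m"] K by simp
  have near: "\<bar>(zval K x (Suc m) + zval K x m) / 2 - zval K x (Suc m)\<bar> \<le> J"
    "\<bar>(zval K x (Suc (Suc m)) + zval K x (Suc m)) / 2 - zval K x (Suc m)\<bar> \<le> J"
    using jump[of m] jump[of "Suc m"] K J by (auto simp: abs_if field_simps split: if_splits)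
  show ?thesis
  proof (cases "s \<le> (x m + x (Suc m)) / 2")
    case True
    have eq: "u_hat K x s = hat_value K x (2 * m) + (hat_value K x (Suc (2 * m)) - hat_value K x (2 * m))
      / (hat_node K x (Suc (2 * m)) - hat_node K x (2 * m)) * (s - hat_node K x (2 * m))"
      unfolding u_hat_def by (rule pw_affine_on_piece[OF mono]) (use K True s m t in auto)
    show ?thesis unfolding m eq t v
      by (intro affine_between) (use near xm True s m J in auto)
  next
    case False
    have eq: "u_hat K x s = hat_value K x (Suc (2 * m)) + (hat_value K x (Suc (Suc (2 * m))) - hat_value K x (Suc (2 * m)))
      / (hat_node K x (Suc (Suc (2 * m))) - hat_node K x (Suc (2 * m))) * (s - hat_node K x (Suc (2 * m)))"
      unfolding u_hat_def by (rule pw_affine_on_piece[OF mono]) (use K False s m t in auto)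
    show ?thesis unfolding m eq t v
      by (intro affine_between) (use near xm False s m J in auto)
  qed
qed

lemma u_hat_outside:
  assumes "0 < K" "s \<notin> {x 0..x K}"
  shows "u_hat K x s = 0"
  unfolding u_hat_def
  by (rule pw_affine_outside) (use assms hat_node_even[of K 0 x] hat_node_even[of K K x] in simp)

lemma continuous_nonneg_integral_zero:
  fixes g :: "real \<Rightarrow> real"
  assumes cont: "continuous_on UNIV g" and nonneg: "\<And>x. 0 \<le> g x"
    and int: "has_bochner_integral lborel g 0"
  shows "g x = 0"
proof (rule ccontr)
  assume "g x \<noteq> 0"
  have "AE x in lborel. g x = 0"
    using integral_nonneg_eq_0_iff_AE[of lborel g] int nonneg by (auto simp: has_bochner_integral_iff)
  then have "{x. g x \<noteq> 0} \<in> null_sets lborel"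
    using AE_iff_null_sets[of "{x. g x \<noteq> 0}" lborel] borel_measurable_continuous_onI[OF cont] by simp
  then have "negligible {x. g x \<noteq> 0}"
    by (simp add: negligible_iff_null_sets null_sets_completionI)
  moreover have "open {x. g x \<noteq> 0}"
    by (intro open_Collect_neq cont continuous_on_const)
  ultimately show False using open_not_negligible \<open>g x \<noteq> 0\<close> by blast
qed

lemma in_Lp_of_bounded_integrable:
  fixes f :: "real \<Rightarrow> real"
  assumes int: "integrable lborel f" and bound: "\<And>x. \<bar>f x\<bar> \<le> M" and p: "1 \<le> p"
  shows "in_Lp p f"
proof -
  have meas: "f \<in> borel_measurable lborel" using int by (rule borel_measurable_integrable)
  have "integrable lborel (\<lambda>x. \<bar>f x\<bar> powr p)"
  proof (rule Bochner_Integration.integrable_bound)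
    show "integrable lborel (\<lambda>x. M powr (p - 1) * f x)" using int by simp
    show "AE x in lborel. norm (\<bar>f x\<bar> powr p) \<le> norm (M powr (p - 1) * f x)"
    proof (intro AE_I2)
      fix x
      have "\<bar>f x\<bar> powr p = \<bar>f x\<bar> powr (p - 1) * \<bar>f x\<bar>"
        using powr_add[of "\<bar>f x\<bar>" "p - 1" 1] by simp
      also have "\<dots> \<le> M powr (p - 1) * \<bar>f x\<bar>"
        using bound p by (intro mult_right_mono powr_mono2) auto
      finally show "norm (\<bar>f x\<bar> powr p) \<le> norm (M powr (p - 1) * f x)" by (simp add: abs_mult)
    qed
    show "(\<lambda>x. \<bar>f x\<bar> powr p) \<in> borel_measurable lborel" using meas by measurable
  qed
  then show ?thesis using meas by (simp add: in_Lp_def)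
qed

text \<open>
  For arbitrary \<open>x\<close>, because membership in \<open>L\<^sup>p\<close> is also demanded for the small \<open>K\<close> that the estimates exclude.
\<close>
lemma in_Lp_u_delta:
  assumes p: "1 \<le> p"
  shows "in_Lp p (u_delta K x)"
proof (rule in_Lp_of_bounded_integrable[OF _ _ p])
  show "integrable lborel (u_delta K x)"
    unfolding u_delta_def[abs_def]
    by (intro Bochner_Integration.integrable_sum integrable_mult_right integrable_real_indicator
        emeasure_Ioc_finite) simp
  show "\<bar>u_delta K x s\<bar> \<le> (\<Sum>k = 1..K. \<bar>delta K / (x k - x (k - 1))\<bar>)" for s
    unfolding u_delta_def
    by (rule order_trans[OF sum_abs]) (intro sum_mono, auto simp: abs_mult indicator_def)
qed

text \<open>
  The property \<open>Q\<close> singles out the limit without prior knowledge that any point satisfies it; here it produces the level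
  of mass 1 together with the convergence to it.
\<close>
lemma convergent_if_cluster_unique:
  fixes c :: "nat \<Rightarrow> real"
  assumes bounded: "\<And>n. c n \<in> {a..b}"
    and cluster: "\<And>r l. strict_mono r \<Longrightarrow> (\<lambda>n. c (r n)) \<longlonglongrightarrow> l \<Longrightarrow> Q l"
    and unique: "\<And>l l'. Q l \<Longrightarrow> Q l' \<Longrightarrow> l = l'"
  obtains l where "c \<longlonglongrightarrow> l" "Q l"
proof -
  have sub: "\<exists>l s. strict_mono s \<and> (\<lambda>n. c (r (s n))) \<longlonglongrightarrow> l" for r :: "nat \<Rightarrow> nat"
    using compact_Icc[of a b, unfolded compact_def, rule_format, of "\<lambda>n. c (r n)"] bounded
    by (auto simp: o_def)
  obtain l s where l: "strict_mono s" "(\<lambda>n. c (s n)) \<longlonglongrightarrow> l" using sub[of id] by auto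
  have Ql: "Q l" by (rule cluster[OF l])
  have "c \<longlonglongrightarrow> l"
  proof (rule tendstoI, rule ccontr)
    fix e :: real assume e: "0 < e" and "\<not> (\<forall>\<^sub>F n in sequentially. dist (c n) l < e)"
    then obtain r :: "nat \<Rightarrow> nat" where r: "strict_mono r" "\<And>n. \<not> dist (c (r n)) l < e"
      using not_eventually_sequentiallyD[of "\<lambda>n. dist (c n) l < e"] by blast
    obtain l' t where t: "strict_mono t" "(\<lambda>n. c (r (t n))) \<longlonglongrightarrow> l'" using sub[of r] by auto
    have "Q l'" using cluster[of "\<lambda>n. r (t n)"] strict_mono_o[OF r(1) t(1)] t(2) by (simp add: o_def)
    then have "l' = l" using unique Ql by blast
    then have "\<forall>\<^sub>F n in sequentially. dist (c (r (t n))) l < e" using t(2) e by (auto dest: tendstoD)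
    then show False using r(2) by (auto simp: eventually_sequentially)
  qed
  then show thesis using that Ql by blast
qed

context entropy_params
begin

text \<open>
  Profiles increase with the level. Equal mass would make two of them coincide, which their values at the origin exclude
  unless both vanish, and then the mass is 0.
\<close>
lemma B_mass_unique:
  assumes "has_bochner_integral lborel (B c) 1" "has_bochner_integral lborel (B c') 1"
  shows "c = c'"
proof -
  have less: False if cc: "c < c'" and m: "has_bochner_integral lborel (B c) 1" "has_bochner_integral lborel (B c') 1" for c c'
  proof -
    have "has_bochner_integral lborel (\<lambda>x. B c' x - B c x) (1 - 1)"
      by (intro has_bochner_integral_diff m)
    then have "B c' x - B c x = 0" for x
      by (intro continuous_nonneg_integral_zero[of "\<lambda>x. B c' x - B c x"])
         (use B_mono cc continuous_B in \<open>auto intro!: continuous_intros\<close>)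
    from this[of 0] have eq: "hinv c' = hinv c" by (simp add: level_profile_def)
    show False
    proof (cases "\<alpha> = 1/2")
      case True
      then show ?thesis using eq cc by (simp add: enthalpy_inv_def)
    next
      case False
      define k where "k = (2 * \<alpha> - 1) / sqrt (2 * \<alpha>)"
      have k: "0 < k" using False alpha_ge by (simp add: k_def)
      have hk: "hinv y = max 0 (k * y) powr (1 / (\<alpha> - 1/2))" for y
        using False by (simp add: enthalpy_inv_def k_def)
      show ?thesis
      proof (cases "0 < c'")
        case True
        then have "max 0 (k * c) < max 0 (k * c')" using k cc by (auto simp: max_def)
        then have "hinv c < hinv c'" unfolding hk
          using False alpha_ge by (intro powr_less_mono2) auto
        then show ?thesis using eq by simp
      next
        case F: False
        have "k * c' \<le> 0" using F k by (simp add: mult_nonneg_nonpos)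
        then have "hinv c' = 0" unfolding hk by simp
        then have "B c' = (\<lambda>x. 0)" using B_le_peak[of c'] B_nonneg[of c'] by (auto simp: fun_eq_iff intro: antisym)
        then show ?thesis using m(2) by (simp add: has_bochner_integral_iff)
      qed
    qed
  qed
  show ?thesis using less assms by (meson linorder_neqE)
qed

lemma barenblatt_eq_B:
  assumes c: "has_bochner_integral lborel (B c) 1"
  shows "barenblatt \<alpha> lam = B c"
proof -
  have "(THE a. has_bochner_integral lborel (profile \<alpha> lam a) 1) = amplitude \<alpha> c"
  proof (rule the_equality)
    show "has_bochner_integral lborel (profile \<alpha> lam (amplitude \<alpha> c)) 1"
      unfolding profile_eq_B by (rule c)
    fix a assume a: "has_bochner_integral lborel (profile \<alpha> lam a) 1"
    have "\<exists>c'. a = amplitude \<alpha> c'"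
    proof (cases "\<alpha> = 1/2")
      case True
      have "0 < a"
      proof (rule ccontr)
        assume "\<not> 0 < a"
        then have "profile \<alpha> lam a x \<le> 0" for x using True by (simp add: profile_def mult_nonpos_nonneg)
        then have "integral\<^sup>L lborel (profile \<alpha> lam a) \<le> 0"
          using Bochner_Integration.integral_nonneg[of lborel "\<lambda>x. - profile \<alpha> lam a x"] by simp
        then show False using a by (simp add: has_bochner_integral_iff)
      qed
      then show ?thesis using True by (intro exI[of _ "ln a / 2"]) (simp add: amplitude_def)
    next
      case False
      then show ?thesis using alpha_ge
        by (intro exI[of _ "a * sqrt (2 * \<alpha>) / (2 * \<alpha> - 1)"]) (simp add: amplitude_def)
    qed
    then obtain c' where c': "a = amplitude \<alpha> c'" by blast
    then show "a = amplitude \<alpha> c"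
      using B_mass_unique[OF c, of c'] a by (simp add: profile_eq_B)
  qed
  then show ?thesis by (simp add: barenblatt_def profile_eq_B)
qed

text \<open>
  The first and the last equilibrium equation show \<open>x 0 < 0 < x K\<close>, so some cell contains the origin.
\<close>
lemma x_min_is_steady:
  assumes K: "2 \<le> K"
  obtains j where "steady \<alpha> lam K (x_min \<alpha> lam K) (zval K (x_min \<alpha> lam K)) j"
proof -
  define x where "x = x_min \<alpha> lam K"
  have x: "x \<in> configs K" and bal: "\<And>k. k \<le> K \<Longrightarrow> P (zval K x k) - P (zval K x (Suc k)) = \<Lambda> * delta K * x k"
    using x_min_steady[of K] K by (auto simp: x_def)
  have d: "0 < delta K" using K by (simp add: delta_def)
  have "\<Lambda> * delta K * x 0 < 0"
    using bal[of 0] flux_pos[OF zval_pos[OF x, of 1]] K by simp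
  then have x0: "x 0 < 0" using d Lambda_pos by (simp add: mult_less_0_iff)
  have "0 < \<Lambda> * delta K * x K"
    using bal[of K] flux_pos[OF zval_pos[OF x, of K]] K by simp
  moreover have "0 < \<Lambda> * delta K" using d Lambda_pos by simp
  ultimately have xK: "0 \<le> x K" by (meson zero_less_mult_pos less_imp_le)
  obtain j where j: "j \<in> {1..K}" "x (j - 1) < 0" "0 \<le> x j"
    by (rule config_cell[OF x0 xK])
  have "steady \<alpha> lam K x (zval K x) j"
    by unfold_locales (use K zval_pos[OF x] bal j configs_step[OF x] d in \<open>auto simp: zval_def\<close>)
  then show thesis using that by (simp add: x_def)
qed

text \<open>
  An upper bound, uniform in \<open>K\<close>, for all levels that occur.
\<close>
definition top_level :: real where "top_level = h peak_max + \<Lambda> / 2 * (1 / peak_min)\<^sup>2"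

lemma level_gap_le: "0 < K \<Longrightarrow> h peak_max + level_gap K \<le> top_level"
  unfolding level_gap_def top_level_def using Lambda_pos peak_min_pos
  by (intro add_left_mono mult_left_mono power_mono divide_right_mono) (auto simp: delta_def)

lemma level_gap_nonneg: "0 \<le> level_gap K" using Lambda_pos by (simp add: level_gap_def)

text \<open>
  The estimates of an equilibrium, with the raised level replaced by \<open>level\<close> at the cost of a Lipschitz constant that does not depend on
  \<open>K\<close>.
\<close>
lemma x_min_estimates:
  obtains C where "0 \<le> C" and
    "\<And>c c' s. c \<le> top_level \<Longrightarrow> c' \<le> top_level \<Longrightarrow> \<bar>B c s - B c' s\<bar> \<le> C * \<bar>c - c'\<bar>" and
    "\<And>K. 2 \<le> K \<Longrightarrow> \<exists>c\<in>{h peak_min..h peak_max}. \<forall>s.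
      0 \<le> u_delta K (x_min \<alpha> lam K) s
      \<and> u_delta K (x_min \<alpha> lam K) s \<le> B (top_level + \<Lambda> * cell_const) s
      \<and> \<bar>u_delta K (x_min \<alpha> lam K) s - B c s\<bar> \<le> jump_bound K + C * level_gap K
      \<and> \<bar>u_hat K (x_min \<alpha> lam K) s - B c s\<bar> \<le> 2 * jump_bound K + C * level_gap K"
proof -
  obtain C where C: "0 \<le> C" "\<And>y y'. y \<le> top_level \<Longrightarrow> y' \<le> top_level \<Longrightarrow> \<bar>hinv y - hinv y'\<bar> \<le> C * \<bar>y - y'\<bar>"
    using hinv_lipschitz[of top_level] by blast
  have lip: "\<bar>B c s - B c' s\<bar> \<le> C * \<bar>c - c'\<bar>" if "c \<le> top_level" "c' \<le> top_level" for c c' s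
  proof -
    have "0 \<le> \<Lambda> / 2 * s\<^sup>2" using Lambda_pos by simp
    then show ?thesis using C(2)[of "c - \<Lambda> / 2 * s\<^sup>2" "c' - \<Lambda> / 2 * s\<^sup>2"] that by (simp add: level_profile_def)
  qed
  show thesis
  proof (rule that[OF C(1) lip])
    fix K :: nat assume K: "2 \<le> K"
    define x where "x = x_min \<alpha> lam K"
    have x: "x \<in> configs K" using x_min_steady[of K] K by (simp add: x_def)
    obtain j where "steady \<alpha> lam K x (zval K x) j" using x_min_is_steady[OF K] by (auto simp: x_def)
    then interpret steady \<alpha> lam K x "zval K x" j .
    define J where "J = jump_bound K"
    have J: "0 \<le> J" by (simp add: J_def jump_bound_nonneg)
    have top: "level + level_gap K \<le> top_level" using level_gap_le[of K] level_in K by simp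
    have lift0: "0 \<le> level_gap K" by (rule level_gap_nonneg)
    have E: "0 \<le> C * level_gap K" using C lift0 by simp
    have diff: "B (level + level_gap K) s \<le> B level s + C * level_gap K" for s
      using lip[of "level + level_gap K" level s] top lift0 by simp
    have near: "\<bar>zval K x k - B level s\<bar> \<le> J + C * level_gap K"
      if "k \<in> {1..K}" "x (k - 1) \<le> s" "s \<le> x k" for k s
      using cell(1,2)[OF that] diff[of s] E unfolding J_def by simp
    have u_cases: "\<exists>k\<in>{1..K}. x (k - 1) \<le> s \<and> s \<le> x k \<and> u_delta K x s = zval K x k"
      if s: "x 0 < s" "s \<le> x K" for s
    proof -
      obtain k where "k \<in> {1..K}" "x (k - 1) < s" "s \<le> x k" by (rule config_cell[OF s])
      then show ?thesis using u_delta_cell[OF x] by (intro bexI[of _ k]) auto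
    qed
    have "0 \<le> u_delta K x s \<and> u_delta K x s \<le> B (top_level + \<Lambda> * cell_const) s
        \<and> \<bar>u_delta K x s - B level s\<bar> \<le> J + C * level_gap K
        \<and> \<bar>u_hat K x s - B level s\<bar> \<le> 2 * J + C * level_gap K" for s
    proof (intro conjI)
      have "0 \<le> u_delta K x s \<and> u_delta K x s \<le> B (top_level + \<Lambda> * cell_const) s
        \<and> \<bar>u_delta K x s - B level s\<bar> \<le> J + C * level_gap K"
      proof (cases "x 0 < s \<and> s \<le> x K")
        case True
        then obtain k where k: "k \<in> {1..K}" "x (k - 1) \<le> s" "s \<le> x k" "u_delta K x s = zval K x k"
          using u_cases by blast
        have "zval K x k \<le> B (level + level_gap K + \<Lambda> * cell_const) s" by (rule cell(3)[OF k(1-3)])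
        also have "\<dots> \<le> B (top_level + \<Lambda> * cell_const) s" using top by (intro B_mono) simp
        finally show ?thesis using near[OF k(1-3)] zval_pos[OF x k(1)] k(4) by simp
      next
        case False
        then have "u_delta K x s = 0" by (intro u_delta_outside[OF x]) auto
        moreover have "B level s \<le> J" unfolding J_def by (rule outside) (use False in auto)
        ultimately show ?thesis using E by simp
      qed
      then show "0 \<le> u_delta K x s" "u_delta K x s \<le> B (top_level + \<Lambda> * cell_const) s"
        "\<bar>u_delta K x s - B level s\<bar> \<le> J + C * level_gap K" by auto
      show "\<bar>u_hat K x s - B level s\<bar> \<le> 2 * J + C * level_gap K"
      proof (cases "x 0 \<le> s \<and> s \<le> x K")
        case True
        obtain k where k: "k \<in> {1..K}" "x (k - 1) \<le> s" "s \<le> x k"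
        proof (cases "x 0 = s")
          case True
          then show thesis using that[of 1] K configs_mono[OF x, of 0 1] by simp
        next
          case False
          then show thesis using u_cases[of s] True that by auto
        qed
        have "\<bar>u_hat K x s - zval K x k\<bar> \<le> J"
          by (rule u_hat_cell[OF x k]) (use jump in \<open>simp add: J_def\<close>)
        then show ?thesis using near[OF k] by simp
      next
        case False
        then have "u_hat K x s = 0" using K by (intro u_hat_outside) auto
        moreover have "B level s \<le> J" unfolding J_def by (rule outside) (use False in auto)
        ultimately show ?thesis using E J by simp
      qed
    qed
    then show "\<exists>c\<in>{h peak_min..h peak_max}. \<forall>s.
      0 \<le> u_delta K (x_min \<alpha> lam K) s
      \<and> u_delta K (x_min \<alpha> lam K) s \<le> B (top_level + \<Lambda> * cell_const) s
      \<and> \<bar>u_delta K (x_min \<alpha> lam K) s - B c s\<bar> \<le> jump_bound K + C * level_gap K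
      \<and> \<bar>u_hat K (x_min \<alpha> lam K) s - B c s\<bar> \<le> 2 * jump_bound K + C * level_gap K"
      using level_in unfolding x_def[symmetric] J_def[symmetric] by (intro bexI[of _ level]) auto
  qed
qed

lemma delta_tendsto: "delta \<longlonglongrightarrow> 0"
  unfolding delta_def[abs_def] by (rule lim_1_over_n)

lemma level_gap_tendsto: "level_gap \<longlonglongrightarrow> 0"
proof -
  have "(\<lambda>K. \<Lambda> / 2 * (delta K / peak_min)\<^sup>2) \<longlonglongrightarrow> \<Lambda> / 2 * (0 / peak_min)\<^sup>2"
    by (intro tendsto_intros delta_tendsto) (use peak_min_pos in simp)
  then show ?thesis by (simp add: level_gap_def[abs_def])
qed

lemma jump_bound_tendsto: "jump_bound \<longlonglongrightarrow> 0"
proof -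
  have "(\<lambda>K. \<Lambda> * sqrt ((delta K * (delta K / peak_min))\<^sup>2 + 2 * cell_const * delta K) / \<Theta>)
      \<longlonglongrightarrow> \<Lambda> * sqrt ((0 * (0 / peak_min))\<^sup>2 + 2 * cell_const * 0) / \<Theta>"
    by (intro tendsto_intros delta_tendsto) (use peak_min_pos Theta_pos in auto)
  then have "(\<lambda>K. \<Lambda> * sqrt ((delta K * (delta K / peak_min))\<^sup>2 + 2 * cell_const * delta K) / \<Theta>) \<longlonglongrightarrow> 0"
    by simp
  moreover have "0 \<le> \<Lambda> * sqrt ((delta K * (delta K / peak_min))\<^sup>2 + 2 * cell_const * delta K) / \<Theta>" for K
    using Lambda_pos Theta_pos cell_const_pos
    by (intro divide_nonneg_nonneg mult_nonneg_nonneg real_sqrt_ge_zero add_nonneg_nonneg) (auto simp: delta_def)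
  ultimately show ?thesis unfolding jump_bound_def[abs_def]
    by (intro tendsto_zero_powrI[where b = "1 / (\<alpha> + 1/2)"]) (use alpha_ge in auto)
qed

lemma B_tendsto:
  assumes "c \<longlonglongrightarrow> l" shows "(\<lambda>n. B (c n) s) \<longlonglongrightarrow> B l s"
  unfolding level_profile_def
  by (rule isCont_tendsto_compose[OF isCont_hinv]) (intro tendsto_intros assms)

text \<open>
  Both limits are uniform with a common rate \<open>e\<close>, and one integrable profile dominates everything. The restriction to at least two
  cells comes from \<open>peak_min_le\<close>.
\<close>
lemma minimizers_converge:
  obtains e where "e \<longlonglongrightarrow> 0"
    and "\<And>K s. 2 \<le> K \<Longrightarrow> \<bar>u_delta K (x_min \<alpha> lam K) s - barenblatt \<alpha> lam s\<bar> \<le> e K"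
    and "\<And>K s. 2 \<le> K \<Longrightarrow> \<bar>u_hat K (x_min \<alpha> lam K) s - barenblatt \<alpha> lam s\<bar> \<le> e K"
    and "\<And>K s. 2 \<le> K \<Longrightarrow> u_delta K (x_min \<alpha> lam K) s \<in> {0..B (top_level + \<Lambda> * cell_const) s}"
    and "\<And>s. barenblatt \<alpha> lam s \<in> {0..B (top_level + \<Lambda> * cell_const) s}"
proof -
  obtain C where C: "0 \<le> C"
    and lip: "\<And>c c' s. c \<le> top_level \<Longrightarrow> c' \<le> top_level \<Longrightarrow> \<bar>B c s - B c' s\<bar> \<le> C * \<bar>c - c'\<bar>"
    and est: "\<And>K. 2 \<le> K \<Longrightarrow> \<exists>c\<in>{h peak_min..h peak_max}. \<forall>s.
      0 \<le> u_delta K (x_min \<alpha> lam K) s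
      \<and> u_delta K (x_min \<alpha> lam K) s \<le> B (top_level + \<Lambda> * cell_const) s
      \<and> \<bar>u_delta K (x_min \<alpha> lam K) s - B c s\<bar> \<le> jump_bound K + C * level_gap K
      \<and> \<bar>u_hat K (x_min \<alpha> lam K) s - B c s\<bar> \<le> 2 * jump_bound K + C * level_gap K"
    using x_min_estimates by blast
  define u where "u K = u_delta K (x_min \<alpha> lam K)" for K
  define w where "w = B (top_level + \<Lambda> * cell_const)"
  have "\<forall>K. \<exists>c. 2 \<le> K \<longrightarrow> c \<in> {h peak_min..h peak_max} \<and> (\<forall>s.
      0 \<le> u K s \<and> u K s \<le> w s
      \<and> \<bar>u K s - B c s\<bar> \<le> jump_bound K + C * level_gap K
      \<and> \<bar>u_hat K (x_min \<alpha> lam K) s - B c s\<bar> \<le> 2 * jump_bound K + C * level_gap K)"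
    using est unfolding u_def w_def by blast
  from choice[OF this] obtain c where c_prop: "\<forall>K. 2 \<le> K \<longrightarrow> c K \<in> {h peak_min..h peak_max} \<and> (\<forall>s.
      0 \<le> u K s \<and> u K s \<le> w s
      \<and> \<bar>u K s - B (c K) s\<bar> \<le> jump_bound K + C * level_gap K
      \<and> \<bar>u_hat K (x_min \<alpha> lam K) s - B (c K) s\<bar> \<le> 2 * jump_bound K + C * level_gap K)" by blast
  then have c_in: "\<And>K. 2 \<le> K \<Longrightarrow> c K \<in> {h peak_min..h peak_max}"
    and u_in: "\<And>K s. 2 \<le> K \<Longrightarrow> u K s \<in> {0..w s}"
    and u_near: "\<And>K s. 2 \<le> K \<Longrightarrow> \<bar>u K s - B (c K) s\<bar> \<le> jump_bound K + C * level_gap K"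
    and hat_near: "\<And>K s. 2 \<le> K \<Longrightarrow> \<bar>u_hat K (x_min \<alpha> lam K) s - B (c K) s\<bar> \<le> 2 * jump_bound K + C * level_gap K"
    by auto
  have err: "(\<lambda>K. jump_bound K + C * level_gap K) \<longlonglongrightarrow> 0" 
    using tendsto_add[OF jump_bound_tendsto tendsto_mult[OF tendsto_const[of C] level_gap_tendsto]] by simp
  \<comment> \<open>The shift by 2 discards the values of \<open>K\<close> for which there is no estimate.\<close>
  have mass: "has_bochner_integral lborel (B l) 1"
    if r: "strict_mono r" and l: "(\<lambda>n. c (r n + 2)) \<longlonglongrightarrow> l" for r l
  proof -
    have shift: "strict_mono (\<lambda>n. r n + 2)" using r by (simp add: strict_mono_def)
    have "(\<lambda>n. integral\<^sup>L lborel (u (r n + 2))) \<longlonglongrightarrow> integral\<^sup>L lborel (B l)"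
    proof (rule integral_dominated_convergence[where w = w])
      show "AE s in lborel. (\<lambda>n. u (r n + 2) s) \<longlonglongrightarrow> B l s"
      proof (intro AE_I2)
        fix s
        have "(\<lambda>n. u (r n + 2) s - B (c (r n + 2)) s) \<longlonglongrightarrow> 0"
          using LIMSEQ_subseq_LIMSEQ[OF err shift]
          by (rule Lim_null_comparison[rotated]) (auto intro!: always_eventually u_near simp: o_def)
        from tendsto_add[OF this B_tendsto[OF l, of s]] show "(\<lambda>n. u (r n + 2) s) \<longlonglongrightarrow> B l s" by simp
      qed
      show "AE s in lborel. norm (u (r n + 2) s) \<le> w s" for n
        using u_in[of "r n + 2"] by auto
    qed (auto simp: w_def u_def integrable_B)
    moreover have "integral\<^sup>L lborel (u (r n + 2)) = 1" for n
      using has_bochner_integral_u_delta[OF x_min_steady(1), of "r n + 2"]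
      by (simp add: u_def has_bochner_integral_iff)
    ultimately have "integral\<^sup>L lborel (B l) = 1" by (simp add: LIMSEQ_const_iff)
    then show ?thesis using integrable_B by (simp add: has_bochner_integral_iff)
  qed
  obtain l where l: "(\<lambda>n. c (n + 2)) \<longlonglongrightarrow> l" "has_bochner_integral lborel (B l) 1"
    by (rule convergent_if_cluster_unique[of "\<lambda>n. c (n + 2)" "h peak_min" "h peak_max"
          "\<lambda>l. has_bochner_integral lborel (B l) 1"])
       (use c_in mass B_mass_unique in auto)
  have limit: "barenblatt \<alpha> lam = B l" by (rule barenblatt_eq_B[OF l(2)])
  have c_lim: "c \<longlonglongrightarrow> l" using l(1) by (rule LIMSEQ_offset)
  have top: "h peak_max \<le> top_level" using Lambda_pos by (simp add: top_level_def)
  have l_top: "l \<le> top_level"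
  proof (rule LIMSEQ_le_const2[OF l(1)])
    show "\<exists>N. \<forall>n\<ge>N. c (n + 2) \<le> top_level"
      using c_in[of "_ + 2"] top by (intro exI[of _ 0]) (auto intro: order_trans)
  qed
  define e where "e K = 2 * jump_bound K + C * level_gap K + C * \<bar>c K - l\<bar>" for K
  have "e \<longlonglongrightarrow> 2 * 0 + C * 0 + C * \<bar>l - l\<bar>"
    unfolding e_def[abs_def] by (intro tendsto_intros jump_bound_tendsto level_gap_tendsto c_lim)
  then have e_lim: "e \<longlonglongrightarrow> 0" by simp
  have shift_level: "\<bar>B (c K) s - B l s\<bar> \<le> C * \<bar>c K - l\<bar>" if "2 \<le> K" for K s
    by (rule lip) (use c_in[OF that] top l_top in auto)
  show thesis
  proof (rule that[OF e_lim])
    fix K :: nat and s :: real assume K: "2 \<le> K"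
    show "\<bar>u_delta K (x_min \<alpha> lam K) s - barenblatt \<alpha> lam s\<bar> \<le> e K"
      using u_near[OF K, of s] shift_level[OF K, of s] jump_bound_nonneg[of K]
      unfolding limit e_def u_def by linarith
    show "\<bar>u_hat K (x_min \<alpha> lam K) s - barenblatt \<alpha> lam s\<bar> \<le> e K"
      using hat_near[OF K, of s] shift_level[OF K, of s] unfolding limit e_def by linarith
    show "u_delta K (x_min \<alpha> lam K) s \<in> {0..B (top_level + \<Lambda> * cell_const) s}"
      using u_in[OF K, of s] by (simp add: u_def w_def)
  next
    fix s
    have "0 \<le> \<Lambda> * cell_const" using Lambda_pos cell_const_pos by simp
    then show "barenblatt \<alpha> lam s \<in> {0..B (top_level + \<Lambda> * cell_const) s}"
      unfolding limit using l_top by (auto intro: B_mono)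
  qed
qed

end

theorem theorem1:
  fixes \<alpha> lam :: real
  assumes "1/2 \<le> \<alpha>" and "\<alpha> \<le> 1" and "0 < lam"
  shows "(\<forall>p::real. p \<ge> 1 \<longrightarrow>
            converges_in_Lp p (\<lambda>K. u_delta K (x_min \<alpha> lam K)) (barenblatt \<alpha> lam)) \<and>
         uniform_limit UNIV (\<lambda>K. u_hat K (x_min \<alpha> lam K)) (barenblatt \<alpha> lam) sequentially"
proof -
  interpret entropy_params \<alpha> lam using assms by unfold_locales
  define u where "u K = u_delta K (x_min \<alpha> lam K)" for K
  define b where "b = barenblatt \<alpha> lam"
  define w where "w = B (top_level + \<Lambda> * cell_const)"
  obtain e where e: "e \<longlonglongrightarrow> 0"
    and u_near: "\<And>K s. 2 \<le> K \<Longrightarrow> \<bar>u K s - b s\<bar> \<le> e K"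
    and hat_near: "\<And>K s. 2 \<le> K \<Longrightarrow> \<bar>u_hat K (x_min \<alpha> lam K) s - b s\<bar> \<le> e K"
    and u_in: "\<And>K s. 2 \<le> K \<Longrightarrow> u K s \<in> {0..w s}"
    and b_in: "\<And>s. b s \<in> {0..w s}"
    using minimizers_converge unfolding u_def b_def w_def by metis
  have u_lim: "(\<lambda>n. u (n + 2) s) \<longlonglongrightarrow> b s" for s
  proof -
    have "(\<lambda>n. u (n + 2) s - b s) \<longlonglongrightarrow> 0"
      using LIMSEQ_ignore_initial_segment[OF e, of 2]
      by (rule Lim_null_comparison[rotated]) (auto intro!: always_eventually u_near)
    then show ?thesis by (rule LIM_zero_cancel)
  qed
  have u_meas: "u K \<in> borel_measurable lborel" for K by (simp add: u_def)
  have b_meas: "b \<in> borel_measurable lborel"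
    by (rule borel_measurable_LIMSEQ_real[of _ "\<lambda>n. u (n + 2)"]) (use u_lim u_meas in auto)
  have w_int: "integrable lborel w" unfolding w_def by (rule integrable_B)
  have w_bound: "\<bar>w s\<bar> \<le> hinv (top_level + \<Lambda> * cell_const)" for s
    using B_le_peak[of "top_level + \<Lambda> * cell_const" s] by (simp add: w_def)
  have b_int: "integrable lborel b"
    by (rule Bochner_Integration.integrable_bound[OF w_int b_meas]) (use b_in in \<open>auto intro!: AE_I2 intro: order_trans[OF _ abs_ge_self]\<close>)
  have "converges_in_Lp p u b" if p: "1 \<le> p" for p
    unfolding converges_in_Lp_def
  proof (intro conjI allI)
    show "in_Lp p (u K)" for K unfolding u_def by (rule in_Lp_u_delta[OF p])
    show "in_Lp p b"
    proof (rule in_Lp_of_bounded_integrable[OF b_int _ p])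
      fix s show "\<bar>b s\<bar> \<le> hinv (top_level + \<Lambda> * cell_const)"
        using b_in[of s] w_bound[of s] by auto
    qed
    have w_Lp: "integrable lborel (\<lambda>s. \<bar>w s\<bar> powr p)"
      using in_Lp_of_bounded_integrable[OF w_int w_bound p] by (simp add: in_Lp_def)
    have "(\<lambda>n. LINT s|lborel. \<bar>u (n + 2) s - b s\<bar> powr p) \<longlonglongrightarrow> (LINT s::real|lborel. 0)"
    proof (rule integral_dominated_convergence[where w = "\<lambda>s. \<bar>w s\<bar> powr p"])
      show "(\<lambda>s. \<bar>u (n + 2) s - b s\<bar> powr p) \<in> borel_measurable lborel" for n
        using u_meas[of "n + 2"] b_meas by measurable
      show "AE s in lborel. (\<lambda>n. \<bar>u (n + 2) s - b s\<bar> powr p) \<longlonglongrightarrow> 0"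
      proof (intro AE_I2 tendsto_zero_powrI)
        fix s show "(\<lambda>n. \<bar>u (n + 2) s - b s\<bar>) \<longlonglongrightarrow> 0"
          using u_lim[of s] by (intro tendsto_rabs_zero LIM_zero)
      qed (use p in auto)
      show "AE s in lborel. norm (\<bar>u (n + 2) s - b s\<bar> powr p) \<le> \<bar>w s\<bar> powr p" for n
      proof (intro AE_I2)
        fix s
        have "\<bar>u (n + 2) s - b s\<bar> powr p \<le> \<bar>w s\<bar> powr p"
          using u_in[of "n + 2" s] b_in[of s] p by (intro powr_mono2) auto
        then show "norm (\<bar>u (n + 2) s - b s\<bar> powr p) \<le> \<bar>w s\<bar> powr p" by simp
      qed
    qed (simp_all add: w_Lp)
    then have "(\<lambda>n. LINT s|lborel. \<bar>u (n + 2) s - b s\<bar> powr p) \<longlonglongrightarrow> 0" by simp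
    then have "(\<lambda>n. Lp_norm p (\<lambda>s. u (n + 2) s - b s)) \<longlonglongrightarrow> 0"
      unfolding Lp_norm_def
      by (rule tendsto_zero_powrI[where b = "1 / p"]) (use p in \<open>auto intro: Bochner_Integration.integral_nonneg\<close>)
    then show "(\<lambda>n. Lp_norm p (\<lambda>s. u n s - b s)) \<longlonglongrightarrow> 0"
      by (rule LIMSEQ_offset)
  qed
  moreover have "uniform_limit UNIV (\<lambda>K. u_hat K (x_min \<alpha> lam K)) b sequentially"
  proof (rule uniform_limitI)
    fix \<epsilon> :: real assume "0 < \<epsilon>"
    then have "\<forall>\<^sub>F K in sequentially. e K < \<epsilon>" using e by (auto dest: order_tendstoD)
    then show "\<forall>\<^sub>F K in sequentially. \<forall>s\<in>UNIV. dist (u_hat K (x_min \<alpha> lam K) s) (b s) < \<epsilon>"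
      using eventually_ge_at_top[of 2]
      by eventually_elim (use hat_near in \<open>auto simp: dist_real_def intro: le_less_trans\<close>)
  qed
  ultimately show ?thesis by (auto simp: u_def[abs_def] b_def)
qed

end
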